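(* Let $X$ be an irreducible (two-sided) shift of finite type, $Y$ a (two-sided) subshift, and $\pi : X \to Y$ a factor map given by a one-block map. Let $f \in C(X)$ be a function which depends on just two coordinates, $x_0x_1$, of each point $x \in X$. Then for each $\nu \in M(Y)$ we have $P(\pi,f)(y) = \Phi_f(y)$ for $\nu$-almost every $y\in Y$, and hence $$\int_Y P(\pi, f)\, d\nu = \int_Y \Phi_f \, d\nu .$$
   Context: Subshifts are over finite alphabets, indexed by $\mathbb{Z}$, with shift map $\sigma$ and the usual metric $\rho$ (so that $\rho(z,x)<2^{-p}$ is equivalent to $z_{[-p,p]}=x_{[-p,p]}$). $C(X)$ is the space of real-valued continuous functions on $X$. $M(Y)$ is the set of $\sigma$-invariant Borel probability measures on $Y$. A factor map $\pi:X\to Y$ is a continuous surjection with $\pi\circ\sigma=\sigma\circ\pi$. It is given by a one-block map if there is a map (also denoted $\pi$) from symbols of $X$ to symbols of $Y$ with $(\pi x)_i=\pi(x_i)$ for all $i$; for a block $B=b_1\cdots b_n$ of $X$ write $\pi(B)=\pi(b_1)\cdots\pi(b_n)$. $\mathcal{B}_n(X)$ denotes the set of $n$-blocks occurring in $X$, $\mathcal{B}(X)=\bigcup_n\mathcal{B}_n(X)$, and $[b_1\cdots b_n]=\{x\in X: x_0=b_1,\dots,x_{n-1}=b_n\}$. Relative pressure function: for $\delta>0$, $n\ge1$, $y\in Y$ let $$P_n(\pi,f,\delta)(y)=\sup\Big\{\sum_{x\in E}\exp\Big(\sum_{i=0}^{n-1}f(\sigma^i x)\Big) : E \text{ is an }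 (n,\delta)\text{-separated subset of } X \text{ contained in } \pi^{-1}\{y\}\Big\},$$ and $$P(\pi,f)(y)=\lim_{\delta\to0}\limsup_{n\to\infty}\frac1n\ln P_n(\pi,f,\delta)(y).$$ Here a set $E$ is $(n,\delta)$-separated if $\max_{0\le i<n}\rho(\sigma^i x,\sigma^i x')>\delta$ for all distinct $x,x'\in E$. Finite-range version: for $f$ depending only on $x_0x_1$, define $F:\mathcal{B}_2(X)\to\mathbb{R}$ by $F(b_0b_1)=\exp(f(x))$ for any $x\in[b_0b_1]$. For a block $B=b_1\cdots b_n\in\mathcal{B}(X)$ put $s_f(B)=F(b_1b_2)F(b_2b_3)\cdots F(b_{n-1}b_n)$ (empty product equal to $1$ when $n=1$). For $w\in\mathcal{B}(Y)$ put $S_f(w)=\sum_{B\in\mathcal{B}(X),\,\pi(B)=w}s_f(B)$. Then $$\Phi_f(y)=\limsup_{n\to\infty}\frac1n\ln S_f(y_0y_1\cdots y_{n-1}),\qquad y\in Y.$$ *)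

theory Defs
  imports "HOL-Probability.Probability"
begin

text \<open>
  An alphabet is a finite type with the discrete topology, so that the type class topology on
  \<^typ>\<open>int \<Rightarrow> 'a\<close> is the product of discrete topologies and \<^const>\<open>borel\<close> is its Borel
  sigma-algebra.
\<close>

definition shift :: "(int \<Rightarrow> 'a) \<Rightarrow> int \<Rightarrow> 'a" where
  "shift x = (\<lambda>i. x (i + 1))"

definition block :: "(int \<Rightarrow> 'a) \<Rightarrow> int \<Rightarrow> nat \<Rightarrow> 'a list" where
  "block x i n = map (\<lambda>k. x (i + int k)) [0..<n]"

definition occurs_in :: "'a list \<Rightarrow> (int \<Rightarrow> 'a) \<Rightarrow> bool" where
  "occurs_in w x \<longleftrightarrow> (\<exists>i. block x i (length w) = w)"

definition language :: "(int \<Rightarrow> 'a) set \<Rightarrow> 'a list set" where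
  "language X = {w. \<exists>x\<in>X. occurs_in w x}"

definition subshift :: "(int \<Rightarrow> 'a::{finite,discrete_topology}) set \<Rightarrow> bool" where
  "subshift X \<longleftrightarrow> closed X \<and> shift ` X = X"

definition shift_of_finite_type :: "(int \<Rightarrow> 'a::{finite,discrete_topology}) set \<Rightarrow> bool" where
  "shift_of_finite_type X \<longleftrightarrow> (\<exists>W. finite W \<and> X = {x. \<forall>w\<in>W. \<not> occurs_in w x})"

definition irreducible_shift :: "(int \<Rightarrow> 'a) set \<Rightarrow> bool" where
  "irreducible_shift X \<longleftrightarrow>
     (\<forall>u\<in>language X. \<forall>v\<in>language X. \<exists>w. u @ w @ v \<in> language X)"

definition factor_map ::
  "(int \<Rightarrow> 'a::{finite,discrete_topology}) set \<Rightarrow> (int \<Rightarrow> 'b::{finite,discrete_topology}) set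
   \<Rightarrow> ((int \<Rightarrow> 'a) \<Rightarrow> (int \<Rightarrow> 'b)) \<Rightarrow> bool" where
  "factor_map X Y \<pi> \<longleftrightarrow>
     continuous_on X \<pi> \<and> \<pi> ` X = Y \<and> (\<forall>x\<in>X. \<pi> (shift x) = shift (\<pi> x))"

definition given_by_one_block_map ::
  "(int \<Rightarrow> 'a) set \<Rightarrow> ((int \<Rightarrow> 'a) \<Rightarrow> (int \<Rightarrow> 'b)) \<Rightarrow> ('a \<Rightarrow> 'b) \<Rightarrow> bool" where
  "given_by_one_block_map X \<pi> \<pi>\<^sub>0 \<longleftrightarrow> (\<forall>x\<in>X. \<forall>i. \<pi> x i = \<pi>\<^sub>0 (x i))"

definition invariant_measures ::
  "(int \<Rightarrow> 'a::{finite,discrete_topology}) set \<Rightarrow> (int \<Rightarrow> 'a) measure set" where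
  "invariant_measures Y =
     {\<nu>. prob_space \<nu> \<and> sets \<nu> = sets (restrict_space borel Y) \<and>
         (\<forall>A\<in>sets \<nu>. emeasure \<nu> (shift -` A \<inter> space \<nu>) = emeasure \<nu> A)}"

definition rho :: "(int \<Rightarrow> 'a) \<Rightarrow> (int \<Rightarrow> 'a) \<Rightarrow> real" where
  "rho x y = (if x = y then 0 else (1/2) ^ (LEAST k. \<exists>i. nat \<bar>i\<bar> = k \<and> x i \<noteq> y i))"

lemma rho_less_iff:
  "rho z x < (1/2) ^ p \<longleftrightarrow> (\<forall>i\<in>{- int p..int p}. z i = x i)"
proof (cases "z = x")
  case True
  then show ?thesis by (simp add: rho_def)
next
  case False
  define Q where "Q = (\<lambda>k. \<exists>i. nat \<bar>i\<bar> = k \<and> z i \<noteq> x i)"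
  define m where "m = (LEAST k. Q k)"
  from False obtain j where "z j \<noteq> x j" by auto
  then have "Q (nat \<bar>j\<bar>)" by (auto simp: Q_def)
  then have Qm: "Q m" unfolding m_def by (rule LeastI)
  have least: "m \<le> k" if "Q k" for k unfolding m_def using that by (rule Least_le)
  have "rho z x = (1/2) ^ m" using False by (simp add: rho_def m_def Q_def)
  then have "rho z x < (1/2) ^ p \<longleftrightarrow> p < m"
    by (simp add: power_strict_decreasing_iff)
  also have "\<dots> \<longleftrightarrow> (\<forall>i\<in>{- int p..int p}. z i = x i)"
  proof
    assume "p < m"
    show "\<forall>i\<in>{- int p..int p}. z i = x i"
    proof (rule ballI, rule ccontr)
      fix i assume i: "i \<in> {- int p..int p}" and "z i \<noteq> x i"
      then have "m \<le> nat \<bar>i\<bar>" by (intro least) (auto simp: Q_def)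
      with \<open>p < m\<close> i show False by auto
    qed
  next
    assume eq: "\<forall>i\<in>{- int p..int p}. z i = x i"
    from Qm obtain i where i: "nat \<bar>i\<bar> = m" "z i \<noteq> x i" by (auto simp: Q_def)
    then have "i \<notin> {- int p..int p}" using eq by blast
    with i show "p < m" by auto
  qed
  finally show ?thesis .
qed

lemma open_iff_rho:
  fixes U :: "(int \<Rightarrow> 'a::{finite,discrete_topology}) set"
  shows "open U \<longleftrightarrow> (\<forall>x\<in>U. \<exists>e>0. \<forall>z. rho z x < e \<longrightarrow> z \<in> U)"
proof
  assume U: "open U"
  show "\<forall>x\<in>U. \<exists>e>0. \<forall>z. rho z x < e \<longrightarrow> z \<in> U"
  proof
    fix x assume "x \<in> U"
    then obtain V where V: "x \<in> Pi\<^sub>E UNIV V" "finite {i. V i \<noteq> UNIV}" "Pi\<^sub>E UNIV V \<subseteq> U"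
      using product_topology_open_contains_basis[of "\<lambda>_. euclidean" UNIV U x] U
      by (auto simp: open_fun_def)
    define p where "p = Max (insert 0 ((\<lambda>i. nat \<bar>i\<bar>) ` {i. V i \<noteq> UNIV}))"
    have p: "nat \<bar>i\<bar> \<le> p" if "V i \<noteq> UNIV" for i
      unfolding p_def using V(2) that by (intro Max_ge) auto
    have "z \<in> U" if "rho z x < (1/2) ^ p" for z
    proof -
      have eq: "z i = x i" if "i \<in> {- int p..int p}" for i
        using \<open>rho z x < (1/2) ^ p\<close> that unfolding rho_less_iff by blast
      have "z i \<in> V i" for i
      proof (cases "V i = UNIV")
        case False
        with p[of i] have "z i = x i" by (intro eq) auto
        with V(1) show ?thesis by (auto simp: PiE_iff)
      qed auto
      with V(3) show ?thesis by (auto simp: PiE_iff)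
    qed
    then show "\<exists>e>0. \<forall>z. rho z x < e \<longrightarrow> z \<in> U"
      by (intro exI[of _ "(1/2) ^ p"]) auto
  qed
next
  assume H: "\<forall>x\<in>U. \<exists>e>0. \<forall>z. rho z x < e \<longrightarrow> z \<in> U"
  show "open U"
  proof (rule topological_space_class.openI)
    fix x assume "x \<in> U"
    with H obtain e where e: "e > 0" "\<And>z. rho z x < e \<Longrightarrow> z \<in> U" by blast
    obtain p :: nat where p: "(1/2::real) ^ p < e"
      using real_arch_pow_inv[OF e(1), of "1/2"] by auto
    define C where "C = Pi\<^sub>E UNIV (\<lambda>i. if i \<in> {- int p..int p} then {x i} else UNIV)"
    have "finite {i. (if i \<in> {- int p..int p} then {x i} else UNIV) \<noteq> UNIV}"
      by (rule finite_subset[of _ "{- int p..int p}"]) auto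
    then have "open C"
      unfolding C_def by (intro open_PiE) (auto intro: Topological_Spaces.open_discrete)
    moreover have "x \<in> C" by (auto simp: C_def)
    moreover have "C \<subseteq> U"
    proof
      fix z assume "z \<in> C"
      then have "\<forall>i\<in>{- int p..int p}. z i = x i"
        by (auto simp: C_def PiE_iff split: if_splits)
      then have "rho z x < (1/2) ^ p" by (simp only: rho_less_iff)
      with p show "z \<in> U" by (intro e(2)) simp
    qed
    ultimately show "\<exists>T. open T \<and> x \<in> T \<and> T \<subseteq> U" by blast
  qed
qed

definition separated :: "nat \<Rightarrow> real \<Rightarrow> (int \<Rightarrow> 'a) set \<Rightarrow> bool" where
  "separated n \<delta> E \<longleftrightarrow>
     (\<forall>x\<in>E. \<forall>x'\<in>E. x \<noteq> x' \<longrightarrow>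
        Max ((\<lambda>i. rho ((shift ^^ i) x) ((shift ^^ i) x')) ` {..<n}) > \<delta>)"

text \<open>
  Restricting to finite \<open>E\<close> does not change the supremum, because subsets of separated sets are
  separated; it only guards against the convention that a sum over an infinite set is 0.
  The supremum is bounded when \<open>f\<close> is continuous on a compact \<open>X\<close>, and \<open>P_n\<close> is positive when
  the fibre over \<open>y\<close> is nonempty.
\<close>

definition P_n ::
  "(int \<Rightarrow> 'a) set \<Rightarrow> ((int \<Rightarrow> 'a) \<Rightarrow> (int \<Rightarrow> 'b)) \<Rightarrow> ((int \<Rightarrow> 'a) \<Rightarrow> real)
   \<Rightarrow> real \<Rightarrow> nat \<Rightarrow> (int \<Rightarrow> 'b) \<Rightarrow> real" where
  "P_n X \<pi> f \<delta> n y =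
     (SUP E\<in>{E. finite E \<and> E \<subseteq> X \<inter> \<pi> -` {y} \<and> separated n \<delta> E}.
        \<Sum>x\<in>E. exp (\<Sum>i<n. f ((shift ^^ i) x)))"

definition relative_pressure ::
  "(int \<Rightarrow> 'a) set \<Rightarrow> ((int \<Rightarrow> 'a) \<Rightarrow> (int \<Rightarrow> 'b)) \<Rightarrow> ((int \<Rightarrow> 'a) \<Rightarrow> real)
   \<Rightarrow> (int \<Rightarrow> 'b) \<Rightarrow> ereal" where
  "relative_pressure X \<pi> f y =
     Lim (at_right 0) (\<lambda>\<delta>. limsup (\<lambda>n. ereal (1 / real n * ln (P_n X \<pi> f \<delta> n y))))"

definition depends_on_x0_x1 ::
  "(int \<Rightarrow> 'a) set \<Rightarrow> ((int \<Rightarrow> 'a) \<Rightarrow> real) \<Rightarrow> bool" where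
  "depends_on_x0_x1 X f \<longleftrightarrow>
     (\<forall>x\<in>X. \<forall>x'\<in>X. x 0 = x' 0 \<longrightarrow> x 1 = x' 1 \<longrightarrow> f x = f x')"

definition F_weight ::
  "(int \<Rightarrow> 'a) set \<Rightarrow> ((int \<Rightarrow> 'a) \<Rightarrow> real) \<Rightarrow> 'a \<Rightarrow> 'a \<Rightarrow> real" where
  "F_weight X f b\<^sub>0 b\<^sub>1 = exp (f (SOME x. x \<in> X \<and> x 0 = b\<^sub>0 \<and> x 1 = b\<^sub>1))"

definition s_weight ::
  "(int \<Rightarrow> 'a) set \<Rightarrow> ((int \<Rightarrow> 'a) \<Rightarrow> real) \<Rightarrow> 'a list \<Rightarrow> real" where
  "s_weight X f B = (\<Prod>i<length B - 1. F_weight X f (B ! i) (B ! Suc i))"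

definition S_weight ::
  "(int \<Rightarrow> 'a) set \<Rightarrow> ('a \<Rightarrow> 'b) \<Rightarrow> ((int \<Rightarrow> 'a) \<Rightarrow> real) \<Rightarrow> 'b list \<Rightarrow> real" where
  "S_weight X \<pi>\<^sub>0 f w = (\<Sum>B\<in>{B \<in> language X. map \<pi>\<^sub>0 B = w}. s_weight X f B)"

definition Phi ::
  "(int \<Rightarrow> 'a) set \<Rightarrow> ('a \<Rightarrow> 'b) \<Rightarrow> ((int \<Rightarrow> 'a) \<Rightarrow> real) \<Rightarrow> (int \<Rightarrow> 'b) \<Rightarrow> ereal" where
  "Phi X \<pi>\<^sub>0 f y = limsup (\<lambda>n. ereal (1 / real n * ln (S_weight X \<pi>\<^sub>0 f (block y 0 n))))"

end

theory Submission
  imports Defs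
begin

text \<open>
  Call a block over the first \<open>n\<close> symbols of \<open>y\<close> a fibre block if it is the initial block
  of a point of the fibre over \<open>y\<close>. Up to factors that do not depend on \<open>n\<close>, \<open>P_n\<close> is the weighted sum over the
  fibre blocks, for every \<open>y\<close> and every \<open>\<delta> < 1\<close>; \<open>\<Phi>\<close> is the growth rate of the sum over all
  blocks. By compactness, for every \<open>y\<close> there is a \<open>K\<close> such that a block of memory length which
  can be continued to the left over \<open>K\<close> symbols of \<open>y\<close> can be continued over the whole past of
  \<open>y\<close>, and likewise for the future. By recurrence, the orbit of almost every \<open>y\<close> visits the set
  of points admitting a fixed \<open>K\<close> at a fixed early time and at a time \<open>n - o(n)\<close>. Between two such
  times every block agrees with a fibre block, so the two sums differ by a factor \<open>exp (o(n))\<close>.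
\<close>

section \<open>Visits of an orbit to a set\<close>

locale measure_preserving = prob_space M for M :: "'a measure" +
  fixes T :: "'a \<Rightarrow> 'a"
  assumes T_measurable [measurable]: "T \<in> measurable M M"
    and T_preserves: "A \<in> sets M \<Longrightarrow> emeasure M (T -` A \<inter> space M) = emeasure M A"
begin

lemma T_pow_measurable [measurable]: "(T ^^ n) \<in> measurable M M"
  by (rule measurable_compose_n) (rule T_measurable)

lemma measure_T_pow_vimage:
  assumes "A \<in> sets M"
  shows "measure M ((T ^^ n) -` A \<inter> space M) = measure M A"
proof (induction n)
  case 0
  then show ?case using assms sets.sets_into_space by (simp add: Int_absorb2)
next
  case (Suc n)
  let ?B = "(T ^^ n) -` A \<inter> space M"
  have "?B \<in> sets M" using assms by measurable
  moreover have "(T ^^ Suc n) -` A \<inter> space M = T -` ?B \<inter> space M"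
    using measurable_space[OF T_measurable] unfolding funpow_Suc_right by auto
  ultimately show ?case using T_preserves[of ?B] Suc by (simp only: measure_def)
qed

text \<open>In terms of the first return time to \<open>G\<close>, this is the event that it exceeds
  \<open>k\<close> on \<open>G\<close>; the sum of the measures over \<open>k\<close> is the
  integral of the return time over \<open>G\<close>.\<close>

definition no_return :: "'a set \<Rightarrow> nat \<Rightarrow> 'a set" where
  "no_return G k = {x \<in> space M. x \<in> G \<and> (\<forall>i<k. (T ^^ Suc i) x \<notin> G)}"

lemma no_return_sets [measurable]:
  assumes [measurable]: "G \<in> sets M"
  shows "no_return G k \<in> sets M"
  unfolding no_return_def by measurable

text \<open>Half of Kac's formula: the measures of the sets of points that avoid \<open>G\<close> for \<open>k\<close> steps
  decrease, and their successive differences are the measures of the sets \<open>no_return G k\<close>.\<close>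

lemma summable_no_return:
  assumes [measurable]: "G \<in> sets M"
  shows "summable (\<lambda>k. measure M (no_return G k))"
proof -
  define U where "U k = {x \<in> space M. \<forall>i<k. (T ^^ i) x \<notin> G}" for k
  have U [measurable]: "U k \<in> sets M" for k unfolding U_def by measurable
  have diff: "measure M (no_return G k) = measure M (U k) - measure M (U (Suc k))" for k
  proof -
    let ?V = "T -` U k \<inter> space M"
    have V: "?V = {x \<in> space M. \<forall>i<k. (T ^^ Suc i) x \<notin> G}"
      using measurable_space[OF T_measurable] unfolding U_def by (auto simp: funpow_swap1)
    \<comment> \<open>Split by whether the point itself lies in \<open>G\<close>; invariance then
      identifies the measure of \<open>?V\<close> with that of \<open>U k\<close>.\<close>
    have "no_return G k \<union> U (Suc k) = ?V" "no_return G k \<inter> U (Suc k) = {}"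
      unfolding V unfolding no_return_def U_def by (auto simp: All_less_Suc2)
    then have "measure M ?V = measure M (no_return G k) + measure M (U (Suc k))"
      by (metis U assms finite_measure_Union no_return_sets)
    moreover have "measure M ?V = measure M (U k)"
      using T_preserves[OF U] by (simp add: measure_def)
    ultimately show ?thesis by simp
  qed
  have "(\<Sum>k<n. measure M (no_return G k)) \<le> 1" for n
  proof -
    have "(\<Sum>k<n. measure M (no_return G k)) = measure M (U 0) - measure M (U n)"
      unfolding diff by (induction n) auto
    also have "\<dots> \<le> 1" using prob_le_1[of "U 0"] by (smt (verit) measure_nonneg)
    finally show ?thesis .
  qed
  then show ?thesis
    by (intro bounded_imp_summable[where B = 1]) (auto simp only: lessThan_Suc_atMost[symmetric] measure_nonneg)
qed

text \<open>Borel-Cantelli: pulling back by a power of \<open>T\<close> preserves the measure, so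
  the times \<open>h k\<close> can be chosen freely.\<close>

lemma AE_eventually_return:
  assumes [measurable]: "G \<in> sets M" and "summable (\<lambda>k. measure M (no_return G (g k)))"
  shows "AE x in M. \<forall>\<^sub>F k in sequentially. (T ^^ h k) x \<notin> no_return G (g k)"
proof -
  have "AE x in M. \<forall>\<^sub>F k in sequentially. x \<in> space M - ((T ^^ h k) -` no_return G (g k) \<inter> space M)"
    by (rule borel_cantelli_AE1) (auto simp: measure_T_pow_vimage assms emeasure_eq_measure)
  then show ?thesis by (rule AE_mp) (auto elim: eventually_mono intro!: AE_I2)
qed

text \<open>Each term of the series is repeated \<open>q\<close> times, so the partial sums stay
  below \<open>q * suminf a\<close>.\<close>

lemma summable_div:
  fixes a :: "nat \<Rightarrow> real"
  assumes "summable a" "\<And>k. 0 \<le> a k" "q > 0"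
  shows "summable (\<lambda>m. a (m div q))"
proof (rule bounded_imp_summable)
  fix n
  have bound: "m < q + n * q" if "m \<le> n" for m
  proof -
    have "n * 1 \<le> n * q" using assms(3) by (intro mult_left_mono) auto
    then show ?thesis using that assms(3) by linarith
  qed
  have "(\<Sum>m\<le>n. a (m div q)) \<le> (\<Sum>m<Suc n * q. a (m div q))"
    using assms by (intro sum_mono2) (auto simp: bound)
  also have "\<dots> = (\<Sum>k<Suc n. \<Sum>m\<in>{k * q..<k * q + q}. a (m div q))"
    by (rule sum.nat_group[symmetric])
  also have "\<dots> = (\<Sum>k<Suc n. real q * a k)"
  proof (rule sum.cong[OF refl])
    fix k
    have "m div q = k" if "m \<in> {k * q..<k * q + q}" for m
      using that by (intro div_nat_eqI) (auto simp: algebra_simps)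
    then show "(\<Sum>m\<in>{k * q..<k * q + q}. a (m div q)) = real q * a k" by simp
  qed
  also have "\<dots> \<le> real q * suminf a"
    unfolding sum_distrib_left[symmetric] using assms by (intro mult_left_mono sum_le_suminf) auto
  finally show "(\<Sum>m\<le>n. a (m div q)) \<le> real q * suminf a" .
qed (use assms in simp)

text \<open>If every visit at a late time \<open>j\<close> is followed by another within
  \<open>j div q\<close> steps, the last visit up to time \<open>n\<close> lies at most
  \<open>n div q\<close> before \<open>n\<close>. Since \<open>q\<close> is arbitrary, the gap is
  o(n) along almost every orbit starting in \<open>G\<close>.\<close>

lemma AE_dense_visits:
  assumes G [measurable]: "G \<in> sets M"
  shows "AE x in M. x \<in> G \<longrightarrow>
    (\<forall>q>0. \<forall>\<^sub>F n in sequentially. \<exists>j\<le>n. (T ^^ j) x \<in> G \<and> q * (n - j) \<le> n)"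
proof -
  \<comment> \<open>Poincare recurrence: with a fixed starting time \<open>m\<close> and growing
    \<open>k\<close>, every visit is followed by a later one.\<close>
  have 1: "AE x in M. \<forall>m. \<forall>\<^sub>F k in sequentially. (T ^^ m) x \<notin> no_return G k"
    unfolding AE_all_countable
    using AE_eventually_return[OF G summable_no_return[OF G]] by (intro allI)
  \<comment> \<open>Here the starting time and the waiting time grow together, which bounds late
    gaps by a small fraction of the time.\<close>
  have 2: "AE x in M. \<forall>q. q > 0 \<longrightarrow> (\<forall>\<^sub>F k in sequentially. (T ^^ k) x \<notin> no_return G (k div q))"
    unfolding AE_all_countable
  proof
    fix q :: nat
    show "AE x in M. q > 0 \<longrightarrow> (\<forall>\<^sub>F k in sequentially. (T ^^ k) x \<notin> no_return G (k div q))"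
      using AE_eventually_return[OF G summable_div[OF summable_no_return[OF G] measure_nonneg], of q "\<lambda>k. k"]
      by (cases "q > 0") auto
  qed
  from 1 2 AE_space show ?thesis
  proof eventually_elim
    case (elim x)
    have sp: "(T ^^ m) x \<in> space M" for m
      using measurable_space[OF T_pow_measurable elim(3)] .
    have nr: "\<exists>i. 1 \<le> i \<and> i \<le> k \<and> (T ^^ (m + i)) x \<in> G"
      if "(T ^^ m) x \<in> G" "(T ^^ m) x \<notin> no_return G k" for m k
    proof -
      from that sp[of m] obtain i where "i < k" "(T ^^ Suc i) ((T ^^ m) x) \<in> G"
        unfolding no_return_def by blast
      then show ?thesis
        using funpow_add[of "Suc i" m T]
        by (intro exI[of _ "Suc i"]) (simp add: add.commute[of m] del: funpow.simps)
    qed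
    show ?case
    proof (intro impI allI)
      fix q :: nat assume x: "x \<in> G" and q: "q > 0"
      have unb: "\<exists>j\<ge>m. (T ^^ j) x \<in> G" for m
      proof (induction m)
        case 0
        then show ?case using x by (intro exI[of _ 0]) auto
      next
        case (Suc m)
        then obtain j where j: "j \<ge> m" "(T ^^ j) x \<in> G" by blast
        obtain k where "(T ^^ j) x \<notin> no_return G k"
          using eventually_happens'[OF _ elim(1)[rule_format, of j]] by auto
        from nr[OF j(2) this] j(1) show ?case by (metis Suc_eq_plus1 add_mono)
      qed
      from elim(2) q obtain m0 where m0: "\<And>k. k \<ge> m0 \<Longrightarrow> (T ^^ k) x \<notin> no_return G (k div q)"
        unfolding eventually_sequentially by blast
      from unb obtain j0 where j0: "j0 \<ge> m0" "(T ^^ j0) x \<in> G" by blast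
      have "\<exists>j\<le>n. (T ^^ j) x \<in> G \<and> q * (n - j) \<le> n" if n: "n \<ge> j0" for n
      proof -
        \<comment> \<open>The last visit up to time \<open>n\<close>; the next one comes within
          \<open>j div q\<close> steps and must fall after \<open>n\<close>.\<close>
        define j where "j = Max {j. j \<le> n \<and> (T ^^ j) x \<in> G}"
        have fin: "finite {j. j \<le> n \<and> (T ^^ j) x \<in> G}" by simp
        have "j \<in> {j. j \<le> n \<and> (T ^^ j) x \<in> G}"
          unfolding j_def using fin n j0 by (intro Max_in) auto
        then have j: "j \<le> n" "(T ^^ j) x \<in> G" by auto
        have mx: "i \<le> j" if "i \<le> n" "(T ^^ i) x \<in> G" for i
          unfolding j_def using fin that by (intro Max_ge) auto
        from mx[of j0] n j0 have "m0 \<le> j" by auto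
        from nr[OF j(2) m0[OF this]] obtain i where i: "1 \<le> i" "i \<le> j div q" "(T ^^ (j + i)) x \<in> G"
          by blast
        with mx[of "j + i"] have "n - j \<le> j div q" by (cases "j + i \<le> n") auto
        then have "q * (n - j) \<le> q * (j div q)" by simp
        also have "\<dots> \<le> n" using j(1) by (meson le_trans times_div_less_eq_dividend)
        finally show ?thesis using j by blast
      qed
      then show "\<forall>\<^sub>F n in sequentially. \<exists>j\<le>n. (T ^^ j) x \<in> G \<and> q * (n - j) \<le> n"
        unfolding eventually_sequentially by blast
    qed
  qed
qed

end

section \<open>Exponential growth rates\<close>

text \<open>Half of \<open>e\<close> is spent on the slope of the error, the other half absorbs the
  constant \<open>c\<close> once \<open>n\<close> is at least \<open>2 * c / e\<close>.\<close>

lemma limsup_rate_le: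
  fixes a b :: "nat \<Rightarrow> real"
  assumes "\<And>e. e > 0 \<Longrightarrow> \<exists>c. \<forall>\<^sub>F n in sequentially. a n \<le> b n + e * real n + c"
  shows "limsup (\<lambda>n. ereal (1 / real n * a n)) \<le> limsup (\<lambda>n. ereal (1 / real n * b n))"
proof (rule ereal_le_epsilon2)
  fix e :: real assume e: "0 < e"
  from assms[of "e / 2"] e obtain c where
    c: "\<forall>\<^sub>F n in sequentially. a n \<le> b n + e / 2 * real n + c" by auto
  have "\<forall>\<^sub>F n in sequentially. 2 * c / e \<le> real n"
    by (metis eventually_at_top_linorder filterlim_at_top filterlim_real_sequentially)
  with c eventually_gt_at_top[of 0]
  have "\<forall>\<^sub>F n in sequentially. ereal (1 / real n * a n) \<le> ereal (1 / real n * b n) + ereal e"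
  proof eventually_elim
    case (elim n)
    then have "a n \<le> b n + e * real n" using e by (simp add: field_simps)
    then show ?case using elim by (simp add: field_simps)
  qed
  then have "limsup (\<lambda>n. ereal (1 / real n * a n)) \<le> limsup (\<lambda>n. ereal (1 / real n * b n) + ereal e)"
    by (rule Limsup_mono)
  also have "\<dots> = limsup (\<lambda>n. ereal (1 / real n * b n)) + ereal e"
    by (rule Limsup_add_ereal_right) auto
  finally show "limsup (\<lambda>n. ereal (1 / real n * a n)) \<le> limsup (\<lambda>n. ereal (1 / real n * b n)) + ereal e" .
qed

text \<open>A factor independent of \<open>n\<close> contributes only the additive constant
  \<open>ln C\<close>.\<close>

lemma limsup_rate_ln_le:
  fixes a b :: "nat \<Rightarrow> real"
  assumes "\<And>n. n > 0 \<Longrightarrow> 0 < a n" "\<And>n. n > 0 \<Longrightarrow> a n \<le> C * b n" "0 < C"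
  shows "limsup (\<lambda>n. ereal (1 / real n * ln (a n))) \<le> limsup (\<lambda>n. ereal (1 / real n * ln (b n)))"
proof (rule limsup_rate_le)
  fix e :: real assume "e > 0"
  have "ln (a n) \<le> ln (b n) + e * real n + ln C" if "n > 0" for n
  proof -
    from assms(1,2)[OF that] \<open>C > 0\<close> have "0 < b n" by (smt (verit) zero_less_mult_pos)
    have "ln (a n) \<le> ln (C * b n)" using assms(1,2)[OF that] by simp
    also have "\<dots> = ln (b n) + ln C" using \<open>0 < b n\<close> \<open>C > 0\<close> by (simp add: ln_mult)
    finally show ?thesis using \<open>e > 0\<close> by (smt (verit) mult_nonneg_nonneg of_nat_0_le_iff)
  qed
  then show "\<exists>c. \<forall>\<^sub>F n in sequentially. ln (a n) \<le> ln (b n) + e * real n + c"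
    by (intro exI[of _ "ln C"]) (auto simp: eventually_sequentially intro!: exI[of _ 1])
qed

section \<open>Blocks and topology of sequence spaces\<close>

lemma shift_pow: "(shift ^^ n) x = (\<lambda>k. x (k + int n))"
  by (induction n) (auto simp: shift_def algebra_simps)

lemma length_block [simp]: "length (block x i n) = n"
  by (simp add: block_def)

lemma nth_block [simp]: "k < n \<Longrightarrow> block x i n ! k = x (i + int k)"
  by (simp add: block_def)

lemma block_eq_iff: "block x i n = block z j n \<longleftrightarrow> (\<forall>k<n. x (i + int k) = z (j + int k))"
  by (auto simp: list_eq_iff_nth_eq)

lemma block_eq_iff_interval: "block x i n = block z i n \<longleftrightarrow> (\<forall>k\<in>{i..<i + int n}. x k = z k)"
proof
  assume H: "block x i n = block z i n"
  show "\<forall>k\<in>{i..<i + int n}. x k = z k"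
  proof
    fix k assume "k \<in> {i..<i + int n}"
    then have "nat (k - i) < n" "i + int (nat (k - i)) = k" by auto
    with H show "x k = z k" unfolding block_eq_iff by metis
  qed
qed (auto simp: block_eq_iff)

lemma finite_words: "finite {B :: 'a::finite list. length B = n}"
  using finite_lists_length_eq[of "UNIV :: 'a set" n] by simp

lemma card_words: "card {B :: 'a::finite list. length B = n} = CARD('a) ^ n"
  using card_lists_length_eq[of "UNIV :: 'a set" n] by simp

lemma finite_coord_bound:
  assumes "finite (J :: int set)"
  obtains p where "J \<subseteq> {- int p..int p}"
proof -
  have "k \<in> {- int p..int p}" if "k \<in> J" "p = Max (insert 0 ((\<lambda>k. nat \<bar>k\<bar>) ` J))" for k p
  proof -
    have "nat \<bar>k\<bar> \<le> p" using that assms by auto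
    then show ?thesis by auto
  qed
  then show ?thesis using that by blast
qed

text \<open>Finitely many coordinates lie in a window around 0, and agreement on such a window
  describes a ball of \<open>rho\<close>.\<close>

lemma open_finite_coords:
  fixes P :: "(int \<Rightarrow> 'a::{finite,discrete_topology}) \<Rightarrow> bool"
  assumes "finite J" "\<And>x z. P x \<Longrightarrow> (\<And>k. k \<in> J \<Longrightarrow> z k = x k) \<Longrightarrow> P z"
  shows "open {x. P x}"
proof -
  obtain p where p: "J \<subseteq> {- int p..int p}" using finite_coord_bound[OF assms(1)] .
  show ?thesis unfolding open_iff_rho
  proof (intro ballI exI[of _ "(1/2) ^ p"] conjI allI impI)
    fix x z :: "int \<Rightarrow> 'a" assume "x \<in> {x. P x}" "rho z x < (1/2) ^ p"
    then have "P x" "\<And>k. k \<in> J \<Longrightarrow> z k = x k" using p unfolding rho_less_iff by auto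
    from assms(2)[OF this] show "z \<in> {x. P x}" by auto
  qed auto
qed

text \<open>The hypothesis is symmetric in \<open>x\<close> and \<open>z\<close>, so it passes to
  the negation of \<open>P\<close>.\<close>

lemma closed_finite_coords:
  fixes P :: "(int \<Rightarrow> 'a::{finite,discrete_topology}) \<Rightarrow> bool"
  assumes "finite J" "\<And>x z. P x \<Longrightarrow> (\<And>k. k \<in> J \<Longrightarrow> z k = x k) \<Longrightarrow> P z"
  shows "closed {x. P x}"
proof -
  have "open {x. \<not> P x}" by (rule open_finite_coords[OF assms(1)]) (metis assms(2))
  then show ?thesis by (simp add: closed_def Collect_neg_eq)
qed

text \<open>Tychonoff's theorem with finite factors.\<close>

lemma compact_sequence_space: "compact (UNIV :: (int \<Rightarrow> 'a::{finite,discrete_topology}) set)"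
proof -
  have "compactin (product_topology (\<lambda>_::int. euclidean :: 'a topology) UNIV) (PiE UNIV (\<lambda>_. UNIV))"
    unfolding compactin_PiE by (auto intro: finite_imp_compact)
  then show ?thesis
    by (simp add: euclidean_product_topology PiE_UNIV_domain)
qed

lemma shift_measurable:
  "shift \<in> borel_measurable (borel :: (int \<Rightarrow> 'a::{finite,discrete_topology}) measure)"
proof (rule borel_measurable_continuous_onI)
  show "continuous_on UNIV (shift :: (int \<Rightarrow> 'a) \<Rightarrow> _)"
    unfolding shift_def
    by (intro continuous_on_coordinatewise_then_product continuous_on_product_coordinates)
qed

text \<open>Elements of \<open>S\<close> with the same image under \<open>r\<close> have distinct
  codes, so at most \<open>card Q\<close> of them share an image, and each costs a factor
  \<open>c\<close>.\<close>

lemma sum_le_sum_coded: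
  fixes s :: "'b \<Rightarrow> real" and t :: "'c \<Rightarrow> real" and r :: "'b \<Rightarrow> 'c" and code :: "'b \<Rightarrow> 'd"
  assumes "finite T" "finite Q" "0 \<le> c"
    and r: "\<And>b. b \<in> S \<Longrightarrow> r b \<in> T" and code: "\<And>b. b \<in> S \<Longrightarrow> code b \<in> Q"
    and inj: "inj_on (\<lambda>b. (code b, r b)) S"
    and le: "\<And>b. b \<in> S \<Longrightarrow> s b \<le> c * t (r b)" and t: "\<And>d. d \<in> T \<Longrightarrow> 0 \<le> t d"
  shows "sum s S \<le> c * real (card Q) * sum t T"
proof -
  have "sum s S \<le> (\<Sum>b\<in>S. c * t (snd (code b, r b)))"
    using le by (intro sum_mono) simp
  also have "\<dots> = (\<Sum>p\<in>(\<lambda>b. (code b, r b)) ` S. c * t (snd p))"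
    by (simp add: sum.reindex[OF inj])
  also have "\<dots> \<le> (\<Sum>p\<in>Q \<times> T. c * t (snd p))"
    using assms by (intro sum_mono2) auto
  also have "\<dots> = (\<Sum>q\<in>Q. \<Sum>d\<in>T. c * t d)"
    unfolding sum.cartesian_product by (rule sum.cong) auto
  also have "\<dots> = c * real (card Q) * sum t T"
    by (simp add: sum_distrib_left[symmetric])
  finally show ?thesis .
qed

section \<open>Shifts of finite type\<close>

lemma block_translate: "block (\<lambda>k. x (k + c)) i n = block x (i + c) n"
  by (simp add: block_def algebra_simps)

text \<open>Forbidden words are forbidden at every position. Negative \<open>c\<close> is needed to
  move a point back from the origin.\<close>

lemma sft_translate:
  assumes "shift_of_finite_type X" "x \<in> X"
  shows "(\<lambda>k. x (k + c)) \<in> X"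
  using assms unfolding shift_of_finite_type_def occurs_in_def by (auto simp: block_translate)

lemma sft_closed:
  fixes X :: "(int \<Rightarrow> 'a::{finite,discrete_topology}) set"
  assumes "shift_of_finite_type X"
  shows "closed X"
proof -
  obtain W where "X = {x. \<forall>w\<in>W. \<not> occurs_in w x}"
    using assms unfolding shift_of_finite_type_def by blast
  then have "X = (\<Inter>w\<in>W. \<Inter>i. {x. block x i (length w) \<noteq> w})"
    by (auto simp: occurs_in_def)
  moreover have "closed {x :: int \<Rightarrow> 'a. block x i (length w) \<noteq> w}" for i and w :: "'a list"
  proof (rule closed_finite_coords)
    fix x z :: "int \<Rightarrow> 'a"
    assume "block x i (length w) \<noteq> w" "\<And>k. k \<in> {i..<i + int (length w)} \<Longrightarrow> z k = x k"
    then show "block z i (length w) \<noteq> w" by (metis block_eq_iff_interval)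
  qed simp
  ultimately show ?thesis by (auto intro: closed_INT)
qed

text \<open>The splicing form of being an \<open>L\<close>-step shift: it allows the past or future
  of a point to be replaced without handling forbidden words.\<close>

definition has_memory :: "(int \<Rightarrow> 'a) set \<Rightarrow> nat \<Rightarrow> bool" where
  "has_memory X L \<longleftrightarrow> (\<forall>a. \<forall>x\<in>X. \<forall>z\<in>X. (\<forall>k\<in>{a..<a + int L}. x k = z k) \<longrightarrow>
     (\<lambda>k. if k < a + int L then z k else x k) \<in> X)"

lemma has_memoryD:
  assumes "has_memory X L" "x \<in> X" "z \<in> X" "\<And>k. k \<in> {a..<a + int L} \<Longrightarrow> x k = z k"
  shows "(\<lambda>k. if k < a + int L then z k else x k) \<in> X"
  using assms unfolding has_memory_def by blast

text \<open>\<open>L\<close> bounds the lengths of the forbidden words, so none of them can reach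
  across the window of agreement.\<close>

lemma sft_has_memory:
  assumes "shift_of_finite_type X"
  obtains L where "has_memory X L"
proof -
  obtain W where W: "finite W" "X = {x. \<forall>w\<in>W. \<not> occurs_in w x}"
    using assms unfolding shift_of_finite_type_def by blast
  obtain L where L: "\<And>w. w \<in> W \<Longrightarrow> length w \<le> L"
    using W(1) finite_nat_set_iff_bounded_le[of "length ` W"] by auto
  have "(\<lambda>k. if k < a + int L then z k else x k) \<in> X" (is "?g \<in> X")
    if xz: "x \<in> X" "z \<in> X" "\<And>k. k \<in> {a..<a + int L} \<Longrightarrow> x k = z k" for a x z
  proof -
    have "\<not> occurs_in w ?g" if w: "w \<in> W" for w
    proof
      assume "occurs_in w ?g"
      then obtain i where i: "block ?g i (length w) = w" unfolding occurs_in_def by blast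
      \<comment> \<open>A word starting before \<open>a\<close> ends before \<open>a + L\<close> and
        is read in \<open>z\<close>; one starting later is read in \<open>x\<close>, as both points
        agree on the window.\<close>
      have "block ?g i (length w) = block (if i < a then z else x) i (length w)"
        using L[OF w] xz(3) unfolding block_eq_iff_interval by auto
      with i xz w show False unfolding W(2) occurs_in_def by (auto split: if_splits)
    qed
    then show ?thesis unfolding W(2) by blast
  qed
  then have "has_memory X L" unfolding has_memory_def by blast
  with that show ?thesis .
qed

section \<open>Blocks of a one-block factor\<close>

locale one_block_factor =
  fixes X :: "(int \<Rightarrow> 'a::{finite,discrete_topology}) set"
    and Y :: "(int \<Rightarrow> 'b::{finite,discrete_topology}) set"
    and \<pi> :: "(int \<Rightarrow> 'a) \<Rightarrow> (int \<Rightarrow> 'b)"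
    and \<pi>\<^sub>0 :: "'a \<Rightarrow> 'b"
    and f :: "(int \<Rightarrow> 'a) \<Rightarrow> real"
  assumes sft: "shift_of_finite_type X"
    and surj: "\<pi> ` X = Y"
    and one_block: "given_by_one_block_map X \<pi> \<pi>\<^sub>0"
    and dep: "depends_on_x0_x1 X f"
begin

lemma factor_eq_iff: "x \<in> X \<Longrightarrow> \<pi> x = y \<longleftrightarrow> (\<forall>k. \<pi>\<^sub>0 (x k) = y k)"
  using one_block unfolding given_by_one_block_map_def by auto

lemma translate: "x \<in> X \<Longrightarrow> (\<lambda>k. x (k + c)) \<in> X"
  using sft_translate[OF sft] .

lemma compact_X: "compact X"
  using closed_Int_compact[OF sft_closed[OF sft] compact_sequence_space] by simp

text \<open>With \<open>a = 0\<close>, \<open>J = {0..<int n}\<close> gives all blocks over the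
  first \<open>n\<close> symbols of \<open>y\<close>, and \<open>J = UNIV\<close> the initial blocks
  of points of the fibre. Half lines express one-sided continuation.\<close>

definition lifts :: "int set \<Rightarrow> int \<Rightarrow> nat \<Rightarrow> (int \<Rightarrow> 'b) \<Rightarrow> 'a list set" where
  "lifts J a n y = {block x a n | x. x \<in> X \<and> (\<forall>k\<in>J. \<pi>\<^sub>0 (x k) = y k)}"

lemma liftsI: "x \<in> X \<Longrightarrow> (\<And>k. k \<in> J \<Longrightarrow> \<pi>\<^sub>0 (x k) = y k) \<Longrightarrow> block x a n \<in> lifts J a n y"
  unfolding lifts_def by blast

lemma lifts_antimono: "J \<subseteq> J' \<Longrightarrow> lifts J' a n y \<subseteq> lifts J a n y"
  unfolding lifts_def by blast

lemma lifts_subset_words: "lifts J a n y \<subseteq> {B. length B = n}"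
  unfolding lifts_def by auto

lemma finite_lifts: "finite (lifts J a n y)"
  using finite_subset[OF lifts_subset_words finite_words] .

text \<open>Compactness: the points of \<open>X\<close> that read \<open>B\<close> and match
  \<open>y\<close> on \<open>J M\<close> form a decreasing sequence of nonempty closed sets.\<close>

lemma lifts_UN:
  assumes J: "\<And>M. finite (J M)" "incseq J" and B: "\<And>M. B \<in> lifts (J M) a n y"
  shows "B \<in> lifts (\<Union>M. J M) a n y"
proof -
  define F where "F M = {x. block x a n = B \<and> (\<forall>k\<in>J M. \<pi>\<^sub>0 (x k) = y k)}" for M
  have "X \<inter> (\<Inter>M\<in>UNIV. F M) \<noteq> {}"
  proof (rule compact_imp_fip_image[OF compact_X])
    fix M
    show "closed (F M)" unfolding F_def
    proof (rule closed_finite_coords)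
      show "finite ({a..<a + int n} \<union> J M)" using J by simp
      fix x z assume x: "block x a n = B \<and> (\<forall>k\<in>J M. \<pi>\<^sub>0 (x k) = y k)"
        and z: "\<And>k. k \<in> {a..<a + int n} \<union> J M \<Longrightarrow> z k = x k"
      have "block z a n = block x a n" unfolding block_eq_iff_interval using z by blast
      with x z show "block z a n = B \<and> (\<forall>k\<in>J M. \<pi>\<^sub>0 (z k) = y k)" by auto
    qed
  next
    fix I' :: "nat set" assume I': "finite I'"
    obtain N where N: "\<And>m. m \<in> I' \<Longrightarrow> m \<le> N"
      using I' finite_nat_set_iff_bounded_le[of I'] by auto
    obtain x where x: "x \<in> X" "x \<in> F N" using B[of N] unfolding lifts_def F_def by auto
    have "x \<in> F m" if "m \<in> I'" for m
      using x(2) incseqD[OF J(2) N[OF that]] unfolding F_def by auto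
    with x(1) show "X \<inter> (\<Inter>i\<in>I'. F i) \<noteq> {}" by blast
  qed
  then show ?thesis unfolding F_def lifts_def by blast
qed

lemma lifts_measurable_finite:
  assumes "finite J"
  shows "Measurable.pred borel (\<lambda>y. B \<in> lifts J a n y)"
proof -
  have "open {y. B \<in> lifts J a n y}"
  proof (rule open_finite_coords[OF assms])
    fix y z assume "B \<in> lifts J a n y" "\<And>k. k \<in> J \<Longrightarrow> z k = y k"
    then show "B \<in> lifts J a n z" unfolding lifts_def by auto
  qed
  then show ?thesis by (simp add: pred_def)
qed

text \<open>If \<open>y\<close> is settled with parameter \<open>K\<close>, then matching \<open>y\<close> on the coordinates \<open>J K\<close>
  suffices to match it on all of \<open>\<Union>M. J M\<close>.\<close>

definition settled :: "(nat \<Rightarrow> int set) \<Rightarrow> nat \<Rightarrow> nat \<Rightarrow> (int \<Rightarrow> 'b) set" where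
  "settled J n K = {y. lifts (J K) 0 n y \<subseteq> lifts (\<Union>M. J M) 0 n y}"

text \<open>Membership of a word in \<open>lifts (J K) 0 n y\<close> either fails from some
  \<open>K\<close> on or, by compactness, persists over the union. There are finitely many words of
  length \<open>n\<close>, so one \<open>K\<close> serves them all.\<close>

lemma ex_settled:
  assumes J: "\<And>M. finite (J M)" "incseq J"
  shows "\<exists>K. y \<in> settled J n K"
proof -
  have "\<forall>\<^sub>F K in sequentially. B \<in> lifts (J K) 0 n y \<longrightarrow> B \<in> lifts (\<Union>M. J M) 0 n y" for B
  proof (cases "\<forall>M. B \<in> lifts (J M) 0 n y")
    case True
    then show ?thesis using lifts_UN[OF J] by simp
  next
    case False
    then obtain M where M: "B \<notin> lifts (J M) 0 n y" by blast
    have "B \<notin> lifts (J K) 0 n y" if "K \<ge> M" for K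
      using M lifts_antimono[OF incseqD[OF J(2) that]] by blast
    then show ?thesis unfolding eventually_sequentially by blast
  qed
  then have "\<forall>\<^sub>F K in sequentially. \<forall>B\<in>{B. length B = n}.
      B \<in> lifts (J K) 0 n y \<longrightarrow> B \<in> lifts (\<Union>M. J M) 0 n y"
    by (intro eventually_ball_finite finite_words) auto
  then obtain K where "\<forall>B\<in>{B. length B = n}.
      B \<in> lifts (J K) 0 n y \<longrightarrow> B \<in> lifts (\<Union>M. J M) 0 n y"
    using eventually_happens'[OF sequentially_bot] by blast
  then show ?thesis unfolding settled_def using lifts_subset_words by blast
qed

text \<open>By compactness, lifting over the union means lifting over every \<open>J M\<close>. This
  leaves a countable combination of conditions on finitely many coordinates.\<close>

lemma settled_sets:
  assumes J: "\<And>M. finite (J M)" "incseq J"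
  shows "settled J n K \<in> sets borel"
proof -
  have "B \<in> lifts (\<Union>M. J M) 0 n y \<longleftrightarrow> (\<forall>M. B \<in> lifts (J M) 0 n y)" for B y
  proof
    show "\<forall>M. B \<in> lifts (J M) 0 n y" if "B \<in> lifts (\<Union>M. J M) 0 n y"
      using that lifts_antimono[of "J _" "\<Union>M. J M"] by blast
  qed (use lifts_UN[OF J] in blast)
  then have eq: "settled J n K =
      {y \<in> space borel. \<forall>B. B \<in> lifts (J K) 0 n y \<longrightarrow> (\<forall>M. B \<in> lifts (J M) 0 n y)}"
    unfolding settled_def by auto
  note [measurable] = lifts_measurable_finite[OF J(1)]
  show ?thesis unfolding eq by measurable
qed

section \<open>Splicing a block into the fibre\<close>

abbreviation past :: "nat \<Rightarrow> nat \<Rightarrow> int set" where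
  "past L M \<equiv> {- int M..<int L}"

abbreviation future :: "nat \<Rightarrow> nat \<Rightarrow> int set" where
  "future L M \<equiv> {0..<int L + int M}"

lemma UN_past: "(\<Union>M. past L M) = {..<int L}"
proof -
  have "k \<in> past L (nat \<bar>k\<bar>)" if "k < int L" for k using that by auto
  then have "{..<int L} \<subseteq> (\<Union>M. past L M)" by blast
  then show ?thesis by auto
qed

lemma UN_future: "(\<Union>M. future L M) = {0..}"
proof -
  have "k \<in> future L (nat (k + 1))" if "0 \<le> k" for k using that by auto
  then have "{0..} \<subseteq> (\<Union>M. future L M)" by blast
  then show ?thesis by auto
qed

text \<open>The memory block of \<open>x\<close> at \<open>i\<close> continues to the left over all
  of \<open>y\<close>, the one at \<open>j\<close> to the right, and both continuations are spliced
  onto \<open>x\<close>. The bounds on \<open>K\<close> and \<open>K'\<close> keep the tested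
  windows inside \<open>{0..<int n}\<close>, where \<open>x\<close> matches
  \<open>y\<close>.\<close>

lemma extend_to_fibre:
  assumes mem: "has_memory X L"
    and x: "x \<in> X" "\<And>k. k \<in> {0..<int n} \<Longrightarrow> \<pi>\<^sub>0 (x k) = y k"
    and i: "(shift ^^ i) y \<in> settled (past L) L K" "K \<le> i"
    and j: "(shift ^^ j) y \<in> settled (future L) L K'" "j + L + K' \<le> n"
    and "i \<le> j"
  obtains z where "z \<in> X" "\<pi> z = y" "\<And>k. k \<in> {int i..<int (j + L)} \<Longrightarrow> z k = x k"
proof -
  have "block (\<lambda>k. x (k + int i)) 0 L \<in> lifts (past L K) 0 L ((shift ^^ i) y)"
    using x translate[OF x(1)] i(2) j(2) \<open>i \<le> j\<close> by (intro liftsI) (auto simp: shift_pow)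
  then have "block (\<lambda>k. x (k + int i)) 0 L \<in> lifts {..<int L} 0 L ((shift ^^ i) y)"
    using i(1) unfolding settled_def UN_past by blast
  then obtain u where u: "u \<in> X" "block u 0 L = block (\<lambda>k. x (k + int i)) 0 L"
      "\<And>k. k < int L \<Longrightarrow> \<pi>\<^sub>0 (u k) = y (k + int i)"
    unfolding lifts_def by (auto simp: shift_pow)
  define ul where "ul = (\<lambda>k. u (k + (- int i)))"
  have ul: "ul \<in> X" unfolding ul_def by (rule translate[OF u(1)])
  have ul_x: "x k = ul k" if "k \<in> {int i..<int i + int L}" for k
    using u(2) that unfolding block_eq_iff_interval ul_def by auto
  have ul_y: "\<pi>\<^sub>0 (ul k) = y k" if "k < int i + int L" for k
    using u(3)[of "k - int i"] that unfolding ul_def by simp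
  have "block (\<lambda>k. x (k + int j)) 0 L \<in> lifts (future L K') 0 L ((shift ^^ j) y)"
    using x translate[OF x(1)] j(2) by (intro liftsI) (auto simp: shift_pow)
  then have "block (\<lambda>k. x (k + int j)) 0 L \<in> lifts {0..} 0 L ((shift ^^ j) y)"
    using j(1) unfolding settled_def UN_future by blast
  then obtain v where v: "v \<in> X" "block v 0 L = block (\<lambda>k. x (k + int j)) 0 L"
      "\<And>k. 0 \<le> k \<Longrightarrow> \<pi>\<^sub>0 (v k) = y (k + int j)"
    unfolding lifts_def by (auto simp: shift_pow)
  define vr where "vr = (\<lambda>k. v (k + (- int j)))"
  have vr: "vr \<in> X" unfolding vr_def by (rule translate[OF v(1)])
  have vr_x: "x k = vr k" if "k \<in> {int j..<int j + int L}" for k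
    using v(2) that unfolding block_eq_iff_interval vr_def by auto
  have vr_y: "\<pi>\<^sub>0 (vr k) = y k" if "int j \<le> k" for k
    using v(3)[of "k - int j"] that unfolding vr_def by simp
  define w where "w = (\<lambda>k. if k < int i + int L then ul k else x k)"
  have w: "w \<in> X" unfolding w_def by (rule has_memoryD[OF mem x(1) ul ul_x])
  have w_x: "w k = x k" if "int i \<le> k" for k using that ul_x unfolding w_def by auto
  have w_y: "\<pi>\<^sub>0 (w k) = y k" if "k < int n" for k
    using that ul_y x(2) unfolding w_def by auto
  \<comment> \<open>The second splice uses the window at \<open>j\<close>, where \<open>w\<close>
    still agrees with \<open>x\<close> because \<open>i \<le> j\<close>.\<close>
  define z where "z = (\<lambda>k. if k < int j + int L then w k else vr k)"
  show ?thesis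
  proof
    show zX: "z \<in> X" unfolding z_def
      by (rule has_memoryD[OF mem vr w]) (use vr_x w_x \<open>i \<le> j\<close> in auto)
    show "\<pi> z = y" unfolding factor_eq_iff[OF zX]
      using w_y vr_y j(2) unfolding z_def by auto
    show "z k = x k" if "k \<in> {int i..<int (j + L)}" for k
      using that w_x unfolding z_def by auto
  qed
qed

section \<open>Weights of blocks and of sets of lifts\<close>

definition lift_sum :: "int set \<Rightarrow> nat \<Rightarrow> (int \<Rightarrow> 'b) \<Rightarrow> real" where
  "lift_sum J n y = (\<Sum>B\<in>lifts J 0 n y. s_weight X f B)"

text \<open>The point picked by \<open>SOME\<close> does not matter, since \<open>f\<close> depends
  only on the two prescribed symbols.\<close>

lemma F_weight_eq:
  assumes "x \<in> X"
  shows "F_weight X f (x k) (x (k + 1)) = exp (f (\<lambda>m. x (m + k)))"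
proof -
  let ?P = "\<lambda>z. z \<in> X \<and> z 0 = x k \<and> z 1 = x (k + 1)"
  have P: "?P (\<lambda>m. x (m + k))" using translate[OF assms, of k] by (simp add: add.commute)
  from someI[of ?P, OF P] have "f (SOME z. ?P z) = f (\<lambda>m. x (m + k))"
    using P dep unfolding depends_on_x0_x1_def by (metis (no_types, lifting))
  then show ?thesis unfolding F_weight_def by simp
qed

text \<open>A nonempty block of \<open>n\<close> symbols has \<open>n - 1\<close> consecutive pairs,
  so the Birkhoff sum stops one term short.\<close>

lemma s_weight_block:
  assumes "x \<in> X"
  shows "s_weight X f (block x 0 n) = exp (\<Sum>k<n - 1. f ((shift ^^ k) x))"
proof -
  have "s_weight X f (block x 0 n) = (\<Prod>k<n - 1. exp (f ((shift ^^ k) x)))"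
    unfolding s_weight_def length_block
  proof (rule prod.cong[OF refl])
    fix k assume "k \<in> {..<n - 1}"
    then have "block x 0 n ! k = x (int k)" "block x 0 n ! Suc k = x (int k + 1)"
      by (auto simp: add.commute)
    then show "F_weight X f (block x 0 n ! k) (block x 0 n ! Suc k) = exp (f ((shift ^^ k) x))"
      using F_weight_eq[OF assms, of "int k"] by (simp add: shift_pow)
  qed
  then show ?thesis by (simp add: exp_sum)
qed

text \<open>A maximum suffices because \<open>f\<close> takes finitely many values on
  \<open>X\<close>; inserting 0 covers an empty \<open>X\<close>.\<close>

definition f_bound :: real where
  "f_bound = Max (insert 0 ((\<lambda>x. \<bar>f x\<bar>) ` X))"

lemma finite_image_f: "finite (f ` X)"
proof -
  have "f x = f (SOME z. z \<in> X \<and> z 0 = x 0 \<and> z 1 = x 1)" if "x \<in> X" for x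
    using F_weight_eq[OF that, of 0] unfolding F_weight_def by simp
  then have "f ` X \<subseteq> (\<lambda>(a, b). f (SOME z. z \<in> X \<and> z 0 = a \<and> z 1 = b)) ` UNIV"
    by (auto intro!: image_eqI[where x = "(_ 0, _ 1)"])
  then show ?thesis by (rule finite_subset) simp
qed

lemma f_bound_nonneg: "0 \<le> f_bound" and f_le_bound: "x \<in> X \<Longrightarrow> \<bar>f x\<bar> \<le> f_bound"
proof -
  have "finite ((\<lambda>x. \<bar>f x\<bar>) ` X)"
    using finite_imageI[OF finite_image_f, of abs] by (simp add: image_image)
  then show "0 \<le> f_bound" "x \<in> X \<Longrightarrow> \<bar>f x\<bar> \<le> f_bound"
    unfolding f_bound_def by auto
qed

lemma shift_pow_in_X: "x \<in> X \<Longrightarrow> (shift ^^ k) x \<in> X"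
  using translate[of x "int k"] by (simp add: shift_pow)

lemma s_weight_lifts_bounds:
  assumes "B \<in> lifts J 0 n y"
  shows "exp (- f_bound * real n) \<le> s_weight X f B" "s_weight X f B \<le> exp (f_bound * real n)"
    "0 < s_weight X f B"
proof -
  from assms obtain x where x: "x \<in> X" "B = block x 0 n" unfolding lifts_def by blast
  have "\<bar>\<Sum>k<n - 1. f ((shift ^^ k) x)\<bar> \<le> (\<Sum>k<n - 1. f_bound)"
    using f_le_bound[OF shift_pow_in_X[OF x(1)]] by (intro order_trans[OF sum_abs] sum_mono) auto
  also have "\<dots> \<le> real n * f_bound"
    using f_bound_nonneg by (auto intro: mult_right_mono)
  finally show "exp (- f_bound * real n) \<le> s_weight X f B" "s_weight X f B \<le> exp (f_bound * real n)"
      "0 < s_weight X f B"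
    unfolding x(2) s_weight_block[OF x(1)] by (auto simp: mult.commute)
qed

text \<open>Each Birkhoff term that reads a coordinate outside \<open>{int i..<int j}\<close>
  changes by at most \<open>2 * f_bound\<close>; all others are equal.\<close>

lemma s_weight_block_comparison:
  assumes "x \<in> X" "z \<in> X" "j \<le> n" and eq: "\<And>k. k \<in> {int i..<int j} \<Longrightarrow> z k = x k"
  shows "s_weight X f (block x 0 n) \<le>
    exp (2 * f_bound * real (i + (n - j))) * s_weight X f (block z 0 n)"
proof -
  let ?\<phi> = "\<lambda>x k. f ((shift ^^ k) x)"
  have "(\<Sum>k<n - 1. ?\<phi> x k) - (\<Sum>k<n - 1. ?\<phi> z k) = (\<Sum>k<n - 1. ?\<phi> x k - ?\<phi> z k)"
    by (simp add: sum_subtractf)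
  \<comment> \<open>The index \<open>j - 1\<close> is exceptional too, as its term reads coordinate
    \<open>j\<close>.\<close>
  also have "\<dots> \<le> (\<Sum>k<n - 1. if k \<in> {..<i} \<union> {j - 1..<n - 1} then 2 * f_bound else 0)"
  proof (rule sum_mono)
    fix k assume k: "k \<in> {..<n - 1}"
    show "?\<phi> x k - ?\<phi> z k \<le> (if k \<in> {..<i} \<union> {j - 1..<n - 1} then 2 * f_bound else 0)"
    proof (cases "k \<in> {..<i} \<union> {j - 1..<n - 1}")
      case True
      then show ?thesis
        using f_le_bound[OF shift_pow_in_X[OF assms(1)], of k]
          f_le_bound[OF shift_pow_in_X[OF assms(2)], of k] by auto
    next
      case False
      with k have "z (int k) = x (int k)" "z (1 + int k) = x (1 + int k)" by (auto intro!: eq)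
      then have "(shift ^^ k) x 0 = (shift ^^ k) z 0" "(shift ^^ k) x 1 = (shift ^^ k) z 1"
        by (simp_all add: shift_pow)
      then have "?\<phi> x k = ?\<phi> z k"
        using dep shift_pow_in_X[OF assms(1)] shift_pow_in_X[OF assms(2)]
        unfolding depends_on_x0_x1_def by blast
      then show ?thesis using f_bound_nonneg by simp
    qed
  qed
  also have "\<dots> = 2 * f_bound * real (card ({..<n - 1} \<inter> ({..<i} \<union> {j - 1..<n - 1})))"
    by (subst sum.inter_restrict[symmetric]) auto
  also have "\<dots> \<le> 2 * f_bound * real (i + (n - j))"
  proof -
    have "card ({..<n - 1} \<inter> ({..<i} \<union> {j - 1..<n - 1})) \<le> card ({..<i} \<union> {j - 1..<n - 1})"
      by (intro card_mono) auto
    also have "\<dots> \<le> i + (n - 1 - (j - 1))" by (rule order_trans[OF card_Un_le]) simp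
    also have "\<dots> \<le> i + (n - j)" using assms(3) by auto
    finally show ?thesis using f_bound_nonneg by (intro mult_left_mono) auto
  qed
  finally have "(\<Sum>k<n - 1. ?\<phi> x k) \<le> 2 * f_bound * real (i + (n - j)) + (\<Sum>k<n - 1. ?\<phi> z k)" by simp
  then show ?thesis
    unfolding s_weight_block[OF assms(1)] s_weight_block[OF assms(2)] by (simp flip: exp_add)
qed

lemma lifts_nonempty: "y \<in> Y \<Longrightarrow> lifts J a n y \<noteq> {}"
  using surj liftsI factor_eq_iff by blast

lemma lift_sum_lower: "y \<in> Y \<Longrightarrow> exp (- f_bound * real n) \<le> lift_sum J n y"
proof -
  assume "y \<in> Y"
  then obtain B where B: "B \<in> lifts J 0 n y" using lifts_nonempty by blast
  have "s_weight X f B \<le> lift_sum J n y"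
    unfolding lift_sum_def using B finite_lifts s_weight_lifts_bounds(3)
    by (intro member_le_sum) (auto intro: less_imp_le)
  with s_weight_lifts_bounds(1)[OF B] show ?thesis by linarith
qed

lemma lift_sum_upper: "lift_sum J n y \<le> CARD('a) ^ n * exp (f_bound * real n)"
proof -
  have "lift_sum J n y \<le> real (card (lifts J 0 n y)) * exp (f_bound * real n)"
    unfolding lift_sum_def using s_weight_lifts_bounds(2) by (intro sum_bounded_above) auto
  also have "\<dots> \<le> real (CARD('a) ^ n) * exp (f_bound * real n)"
    using card_mono[OF finite_words lifts_subset_words[of J 0 n y]]
    unfolding card_words by (intro mult_right_mono of_nat_mono) auto
  finally show ?thesis by simp
qed

lemma lift_sum_pos: "y \<in> Y \<Longrightarrow> 0 < lift_sum J n y"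
  using lift_sum_lower[of y n J] by (smt (verit) exp_gt_zero)

lemma lift_sum_antimono: "J \<subseteq> J' \<Longrightarrow> lift_sum J' n y \<le> lift_sum J n y"
  unfolding lift_sum_def using lifts_antimono finite_lifts s_weight_lifts_bounds(3)
  by (intro sum_mono2) (auto intro: less_imp_le)

text \<open>A bound uniform in \<open>y\<close>, for finiteness and integrability. \<open>J\<close>
  may vary with \<open>n\<close> so that both growth rates are covered.\<close>

lemma limsup_lift_sum_bound:
  assumes y: "y \<in> Y"
  shows "\<bar>limsup (\<lambda>n. ereal (1 / real n * ln (lift_sum (J n) n y)))\<bar> \<le> ereal (ln CARD('a) + f_bound)"
    (is "\<bar>limsup ?u\<bar> \<le> ereal ?c")
proof -
  have bnd: "- ?c \<le> 1 / real n * ln (lift_sum (J n) n y) \<and> 1 / real n * ln (lift_sum (J n) n y) \<le> ?c"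
    if "n > 0" for n
  proof -
    have "- f_bound * real n \<le> ln (lift_sum (J n) n y)"
      using lift_sum_lower[OF y, of n "J n"] lift_sum_pos[OF y, of "J n" n] by (simp add: ln_ge_iff)
    moreover have "ln (lift_sum (J n) n y) \<le> ln (CARD('a) ^ n * exp (f_bound * real n))"
      using lift_sum_upper[of "J n" n y] lift_sum_pos[OF y, of "J n" n] by simp
    moreover have "ln (CARD('a) ^ n * exp (f_bound * real n)) = real n * ?c"
      by (simp add: ln_mult ln_realpow algebra_simps)
    moreover have "0 \<le> ln (real CARD('a))" by simp
    ultimately have "- ?c * real n \<le> ln (lift_sum (J n) n y)" "ln (lift_sum (J n) n y) \<le> ?c * real n"
      by (smt (verit) mult_right_mono of_nat_0_le_iff mult.commute)+
    then show ?thesis using that by (simp add: field_simps)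
  qed
  have "limsup ?u \<le> ereal ?c"
    by (rule Limsup_bounded) (use bnd in \<open>auto simp: eventually_sequentially intro!: exI[of _ 1]\<close>)
  moreover have "ereal (- ?c) \<le> limsup ?u"
    by (rule order_trans[OF Liminf_bounded Liminf_le_Limsup])
      (use bnd in \<open>auto simp: eventually_sequentially intro!: exI[of _ 1]\<close>)
  ultimately show ?thesis by (cases "limsup ?u") auto
qed

text \<open>A word of the language may occur anywhere in a point; translation moves the occurrence
  to position 0.\<close>

lemma Phi_eq: "Phi X \<pi>\<^sub>0 f y = limsup (\<lambda>n. ereal (1 / real n * ln (lift_sum {0..<int n} n y)))"
proof -
  have "{B \<in> language X. map \<pi>\<^sub>0 B = block y 0 n} = lifts {0..<int n} 0 n y" for n
  proof (intro set_eqI iffI)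
    fix B assume "B \<in> {B \<in> language X. map \<pi>\<^sub>0 B = block y 0 n}"
    then obtain x i where x: "x \<in> X" "block x i (length B) = B" and B: "map \<pi>\<^sub>0 B = block y 0 n"
      unfolding language_def occurs_in_def by blast
    have len: "length B = n" using B by (metis length_block length_map)
    have B_eq: "B = block (\<lambda>k. x (k + i)) 0 n" using x len by (simp add: block_translate)
    moreover have "\<pi>\<^sub>0 (x (k + i)) = y k" if "k \<in> {0..<int n}" for k
    proof -
      from that have k: "nat k < n" "int (nat k) = k" by auto
      have "map \<pi>\<^sub>0 B ! nat k = y k" using k B by simp
      then show ?thesis using k len unfolding B_eq by simp
    qed
    ultimately show "B \<in> lifts {0..<int n} 0 n y" using liftsI[OF translate[OF x(1)]] by metis
  next
    fix B assume "B \<in> lifts {0..<int n} 0 n y"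
    then obtain x where x: "x \<in> X" "\<And>k. k \<in> {0..<int n} \<Longrightarrow> \<pi>\<^sub>0 (x k) = y k" "B = block x 0 n"
      unfolding lifts_def by blast
    then have "occurs_in B x" unfolding occurs_in_def by auto
    moreover have "map \<pi>\<^sub>0 B = block y 0 n" using x(2) unfolding x(3) by (intro nth_equalityI) auto
    ultimately show "B \<in> {B \<in> language X. map \<pi>\<^sub>0 B = block y 0 n}"
      using x(1) unfolding language_def by blast
  qed
  then show ?thesis unfolding Phi_def S_weight_def lift_sum_def by simp
qed

section \<open>The relative pressure as a growth rate of fibre blocks\<close>

text \<open>Separation at some time \<open>i < n\<close> on a scale of at least
  \<open>(1/2) ^ p\<close> shows within distance \<open>p\<close> of coordinate
  \<open>i\<close>.\<close>

lemma separated_differ: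
  assumes sep: "separated n \<delta> E" and "(1/2) ^ p \<le> \<delta>" "n > 0" "x \<in> E" "x' \<in> E" "x \<noteq> x'"
  shows "\<exists>k\<in>{- int p..<int (n + p)}. x k \<noteq> x' k"
proof -
  have "Max ((\<lambda>i. rho ((shift ^^ i) x) ((shift ^^ i) x')) ` {..<n}) > \<delta>"
    using assms unfolding separated_def by blast
  then obtain i where i: "i < n" "rho ((shift ^^ i) x) ((shift ^^ i) x') > \<delta>"
    using \<open>n > 0\<close> by (subst (asm) Max_gr_iff) auto
  then have "\<not> rho ((shift ^^ i) x) ((shift ^^ i) x') < (1/2) ^ p" using assms(2) by linarith
  then obtain k where "k \<in> {- int p..int p}" "x (k + int i) \<noteq> x' (k + int i)"
    unfolding rho_less_iff shift_pow by blast
  then show ?thesis using i(1) by (intro bexI[of _ "k + int i"]) auto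
qed

text \<open>Points that differ at coordinate \<open>i\<close> have \<open>i\<close>-th shifts that
  differ at 0, hence at distance 1.\<close>

lemma separatedI:
  assumes "\<delta> < 1" "\<And>x x'. x \<in> E \<Longrightarrow> x' \<in> E \<Longrightarrow> x \<noteq> x' \<Longrightarrow> block x 0 n \<noteq> block x' 0 n"
  shows "separated n \<delta> E"
  unfolding separated_def
proof (intro ballI impI)
  fix x x' assume x: "x \<in> E" "x' \<in> E" "x \<noteq> x'"
  then obtain i where i: "i < n" "x (int i) \<noteq> x' (int i)"
    using assms(2) unfolding block_eq_iff by auto
  then have "\<not> rho ((shift ^^ i) x) ((shift ^^ i) x') < (1/2) ^ 0"
    unfolding rho_less_iff shift_pow by (auto intro!: bexI[of _ 0])
  then have "rho ((shift ^^ i) x) ((shift ^^ i) x') > \<delta>" using assms(1) by simp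
  then show "Max ((\<lambda>i. rho ((shift ^^ i) x) ((shift ^^ i) x')) ` {..<n}) > \<delta>"
    using i(1) by (subst Max_gr_iff) auto
qed

text \<open>The full Birkhoff sum has one term more than the weight of the block.\<close>

lemma exp_birkhoff_sum:
  assumes "x \<in> X" "n > 0"
  shows "exp (\<Sum>k<n. f ((shift ^^ k) x)) \<le> exp f_bound * s_weight X f (block x 0 n)"
    and "s_weight X f (block x 0 n) \<le> exp f_bound * exp (\<Sum>k<n. f ((shift ^^ k) x))"
proof -
  from \<open>n > 0\<close> obtain m where n: "n = Suc m" by (cases n) auto
  show "exp (\<Sum>k<n. f ((shift ^^ k) x)) \<le> exp f_bound * s_weight X f (block x 0 n)"
    "s_weight X f (block x 0 n) \<le> exp f_bound * exp (\<Sum>k<n. f ((shift ^^ k) x))"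
    unfolding s_weight_block[OF assms(1)] n using f_le_bound[OF shift_pow_in_X[OF assms(1)], of m]
    by (auto simp flip: exp_add)
qed

text \<open>A point of \<open>E\<close> is determined within \<open>E\<close> by its initial block
  and the \<open>p\<close> symbols on either side, which serve as the code. The resulting factor
  does not depend on \<open>n\<close>.\<close>

lemma separated_sum_le:
  assumes "finite E" "E \<subseteq> X \<inter> \<pi> -` {y}" "separated n \<delta> E" "(1/2) ^ p \<le> \<delta>" "n > 0"
  shows "(\<Sum>x\<in>E. exp (\<Sum>k<n. f ((shift ^^ k) x)))
    \<le> exp f_bound * real (CARD('a) ^ p * CARD('a) ^ p) * lift_sum UNIV n y"
proof -
  let ?W = "{B :: 'a list. length B = p}"
  have "(\<Sum>x\<in>E. exp (\<Sum>k<n. f ((shift ^^ k) x)))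
      \<le> exp f_bound * real (card (?W \<times> ?W)) * sum (s_weight X f) (lifts UNIV 0 n y)"
  proof (rule sum_le_sum_coded[where r = "\<lambda>x. block x 0 n"
        and code = "\<lambda>x. (block x (- int p) p, block x (int n) p)"])
    show "inj_on (\<lambda>x. ((block x (- int p) p, block x (int n) p), block x 0 n)) E"
    proof (rule inj_onI, rule ccontr)
      fix x x' assume x: "x \<in> E" "x' \<in> E" "x \<noteq> x'"
        and eq: "((block x (- int p) p, block x (int n) p), block x 0 n) =
          ((block x' (- int p) p, block x' (int n) p), block x' 0 n)"
      from separated_differ[OF assms(3-5) x] obtain k where
        "k \<in> {- int p..<int (n + p)}" "x k \<noteq> x' k" by blast
      moreover from eq have "\<forall>k\<in>{- int p..<0}. x k = x' k" "\<forall>k\<in>{0..<int n}. x k = x' k"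
        "\<forall>k\<in>{int n..<int (n + p)}. x k = x' k"
        by (simp_all add: block_eq_iff_interval)
      ultimately show False by (metis atLeastLessThan_iff not_le)
    qed
    show "block x 0 n \<in> lifts UNIV 0 n y" if "x \<in> E" for x
      using that assms(2) factor_eq_iff by (intro liftsI) auto
    show "exp (\<Sum>k<n. f ((shift ^^ k) x)) \<le> exp f_bound * s_weight X f (block x 0 n)" if "x \<in> E" for x
      using that assms(2,5) by (intro exp_birkhoff_sum) auto
  qed (use finite_lifts finite_words[where 'a = 'a] s_weight_lifts_bounds(3) in \<open>auto intro: less_imp_le\<close>)
  then show ?thesis unfolding lift_sum_def card_cartesian_product card_words .
qed

lemma P_n_le:
  assumes "(1/2) ^ p \<le> \<delta>" "n > 0"
  shows "P_n X \<pi> f \<delta> n y \<le> exp f_bound * real (CARD('a) ^ p * CARD('a) ^ p) * lift_sum UNIV n y"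
  unfolding P_n_def
proof (rule cSUP_least)
  show "{E. finite E \<and> E \<subseteq> X \<inter> \<pi> -` {y} \<and> separated n \<delta> E} \<noteq> {}"
    by (auto intro!: exI[of _ "{}"] simp: separated_def)
qed (use separated_sum_le assms in blast)

text \<open>One point of the fibre is chosen for each fibre block; distinct blocks make these points
  separated since \<open>\<delta> < 1\<close>.\<close>

lemma lift_sum_le_P_n:
  assumes "0 < \<delta>" "\<delta> < 1" "n > 0"
  shows "lift_sum UNIV n y \<le> exp f_bound * P_n X \<pi> f \<delta> n y"
proof -
  let ?S = "\<lambda>E. \<Sum>x\<in>E. exp (\<Sum>k<n. f ((shift ^^ k) x))"
  have "\<exists>x. x \<in> X \<and> \<pi> x = y \<and> block x 0 n = B" if "B \<in> lifts UNIV 0 n y" for B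
    using that factor_eq_iff unfolding lifts_def by auto
  then obtain pt where pt: "\<And>B. B \<in> lifts UNIV 0 n y \<Longrightarrow> pt B \<in> X"
      "\<And>B. B \<in> lifts UNIV 0 n y \<Longrightarrow> \<pi> (pt B) = y"
      "\<And>B. B \<in> lifts UNIV 0 n y \<Longrightarrow> block (pt B) 0 n = B" by metis
  define E where "E = pt ` lifts UNIV 0 n y"
  have inj: "inj_on pt (lifts UNIV 0 n y)" using pt(3) by (metis inj_onI)
  have E: "finite E" "E \<subseteq> X \<inter> \<pi> -` {y}" "separated n \<delta> E"
    unfolding E_def using finite_lifts pt assms(2) by (auto intro!: separatedI)
  \<comment> \<open>\<open>p\<close> only serves to show that the set whose supremum defines
    \<open>P_n\<close> is bounded.\<close>
  obtain p where p: "(1/2 :: real) ^ p \<le> \<delta>"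
    using real_arch_pow_inv[OF assms(1), of "1/2"] by (auto intro: less_imp_le)
  have "lift_sum UNIV n y \<le> (\<Sum>B\<in>lifts UNIV 0 n y. exp f_bound * exp (\<Sum>k<n. f ((shift ^^ k) (pt B))))"
    unfolding lift_sum_def using exp_birkhoff_sum(2)[OF pt(1) assms(3)] pt(3) by (intro sum_mono) metis
  also have "\<dots> = exp f_bound * ?S E"
    unfolding E_def sum.reindex[OF inj] by (simp add: sum_distrib_left)
  also have "?S E \<le> P_n X \<pi> f \<delta> n y"
    unfolding P_n_def
  proof (rule cSUP_upper)
    show "bdd_above (?S ` {E. finite E \<and> E \<subseteq> X \<inter> \<pi> -` {y} \<and> separated n \<delta> E})"
      using separated_sum_le[OF _ _ _ p assms(3)] by (intro bdd_aboveI2) blast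
  qed (use E in auto)
  finally show ?thesis by simp
qed

text \<open>The growth rate is the same for all \<open>\<delta>\<close> between 0 and 1, so the
  limit is that of an eventually constant function.\<close>

lemma relative_pressure_eq:
  assumes y: "y \<in> Y"
  shows "relative_pressure X \<pi> f y = limsup (\<lambda>n. ereal (1 / real n * ln (lift_sum UNIV n y)))"
proof -
  have eq: "limsup (\<lambda>n. ereal (1 / real n * ln (P_n X \<pi> f \<delta> n y))) =
      limsup (\<lambda>n. ereal (1 / real n * ln (lift_sum UNIV n y)))" if \<delta>: "0 < \<delta>" "\<delta> < 1" for \<delta>
  proof (rule antisym)
    obtain p where p: "(1/2 :: real) ^ p \<le> \<delta>"
      using real_arch_pow_inv[OF \<delta>(1), of "1/2"] by (auto intro: less_imp_le)
    have pos: "0 < P_n X \<pi> f \<delta> n y" if "n > 0" for n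
      using lift_sum_le_P_n[OF \<delta> that, of y] lift_sum_pos[OF y, of UNIV n]
      by (smt (verit) exp_gt_zero zero_less_mult_pos)
    show "limsup (\<lambda>n. ereal (1 / real n * ln (P_n X \<pi> f \<delta> n y))) \<le>
        limsup (\<lambda>n. ereal (1 / real n * ln (lift_sum UNIV n y)))"
      using pos P_n_le[OF p] by (rule limsup_rate_ln_le) auto
    show "limsup (\<lambda>n. ereal (1 / real n * ln (lift_sum UNIV n y))) \<le>
        limsup (\<lambda>n. ereal (1 / real n * ln (P_n X \<pi> f \<delta> n y)))"
      using lift_sum_pos[OF y] lift_sum_le_P_n[OF \<delta>] by (rule limsup_rate_ln_le) auto
  qed
  have "\<forall>\<^sub>F \<delta>::real in at_right 0. 0 < \<delta> \<and> \<delta> < 1"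
    using eventually_at_right_field[of _ "0::real"] by (auto intro: exI[of _ 1])
  then have "\<forall>\<^sub>F \<delta> in at_right 0. limsup (\<lambda>n. ereal (1 / real n * ln (P_n X \<pi> f \<delta> n y))) =
      limsup (\<lambda>n. ereal (1 / real n * ln (lift_sum UNIV n y)))"
    by (rule eventually_mono) (use eq in blast)
  then show ?thesis
    unfolding relative_pressure_def by (intro tendsto_Lim tendsto_eventually) auto
qed

text \<open>For \<open>UNIV\<close>, exhaustion by finite windows and compactness give a countable
  conjunction of finite-coordinate conditions.\<close>

lemma lift_sum_measurable:
  assumes "finite J \<or> J = UNIV"
  shows "lift_sum J n \<in> borel_measurable borel"
proof -
  have [measurable]: "Measurable.pred borel (\<lambda>y. B \<in> lifts J 0 n y)" for B
  proof (cases "finite J")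
    case True
    then show ?thesis by (rule lifts_measurable_finite)
  next
    case False
    define I where "I M = {- int M..int M}" for M
    have "k \<in> I (nat \<bar>k\<bar>)" for k unfolding I_def by auto
    then have UN: "(\<Union>M. I M) = UNIV" by blast
    have I: "finite (I M)" "incseq I" for M unfolding I_def by (auto simp: incseq_def)
    have eq: "B \<in> lifts J 0 n y \<longleftrightarrow> (\<forall>M. B \<in> lifts (I M) 0 n y)" for y
      using lifts_UN[OF I, of B 0 n y] lifts_antimono[of "I _" UNIV 0 n y] False assms unfolding UN by blast
    note [measurable] = lifts_measurable_finite[OF I(1)]
    show ?thesis unfolding eq by measurable
  qed
  \<comment> \<open>Over a fixed index set of words, only the indicators depend on
    \<open>y\<close>.\<close>
  have "lift_sum J n y = (\<Sum>B\<in>{B. length B = n}. if B \<in> lifts J 0 n y then s_weight X f B else 0)" for y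
    unfolding lift_sum_def using lifts_subset_words[of J 0 n y]
    by (subst sum.inter_restrict[OF finite_words, symmetric]) (simp add: Int_absorb1)
  then have eq: "lift_sum J n = (\<lambda>y. \<Sum>B\<in>{B. length B = n}. if B \<in> lifts J 0 n y then s_weight X f B else 0)"
    by blast
  show ?thesis unfolding eq by measurable
qed

section \<open>Almost every fibre\<close>

text \<open>Each block is sent to a fibre block that agrees with it on
  \<open>{int i..<int (j + L)}\<close>, and its remaining symbols are the code. Each of these costs
  \<open>exp (2 * f_bound)\<close> in weight and \<open>CARD('a)\<close> in multiplicity.\<close>

lemma lift_sum_le_fibre:
  assumes mem: "has_memory X L"
    and i: "(shift ^^ i) y \<in> settled (past L) L K" "K \<le> i"
    and j: "(shift ^^ j) y \<in> settled (future L) L K'" "j + L + K' \<le> n"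
    and "i \<le> j"
  shows "lift_sum {0..<int n} n y \<le>
    (exp (2 * f_bound) * CARD('a)) ^ (i + (n - (j + L))) * lift_sum UNIV n y"
proof -
  let ?m = "n - (j + L)"
  let ?W = "\<lambda>p. {B :: 'a list. length B = p}"
  have "\<exists>x z. x \<in> X \<and> z \<in> X \<and> \<pi> z = y \<and> B = block x 0 n \<and> (\<forall>k\<in>{int i..<int (j + L)}. z k = x k)"
    if "B \<in> lifts {0..<int n} 0 n y" for B
  proof -
    from that obtain x where x: "x \<in> X" "\<And>k. k \<in> {0..<int n} \<Longrightarrow> \<pi>\<^sub>0 (x k) = y k" "B = block x 0 n"
      unfolding lifts_def by blast
    from extend_to_fibre[OF mem x(1,2) i j \<open>i \<le> j\<close>] x show ?thesis by metis
  qed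
  then obtain x z where xz: "\<And>B. B \<in> lifts {0..<int n} 0 n y \<Longrightarrow>
      x B \<in> X \<and> z B \<in> X \<and> \<pi> (z B) = y \<and> B = block (x B) 0 n \<and>
      (\<forall>k\<in>{int i..<int (j + L)}. z B k = x B k)" by metis
  have "sum (s_weight X f) (lifts {0..<int n} 0 n y) \<le>
      exp (2 * f_bound * real (i + ?m)) * real (card (?W i \<times> ?W ?m)) *
      sum (s_weight X f) (lifts UNIV 0 n y)"
  proof (rule sum_le_sum_coded[where r = "\<lambda>B. block (z B) 0 n"
        and code = "\<lambda>B. (block (x B) 0 i, block (x B) (int (j + L)) ?m)"])
    show "inj_on (\<lambda>B. ((block (x B) 0 i, block (x B) (int (j + L)) ?m), block (z B) 0 n))
        (lifts {0..<int n} 0 n y)"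
    proof (rule inj_onI)
      fix B B' assume B: "B \<in> lifts {0..<int n} 0 n y" "B' \<in> lifts {0..<int n} 0 n y"
        and eq: "((block (x B) 0 i, block (x B) (int (j + L)) ?m), block (z B) 0 n) =
          ((block (x B') 0 i, block (x B') (int (j + L)) ?m), block (z B') 0 n)"
      have "x B k = x B' k" if k: "k \<in> {0..<int n}" for k
      proof -
        consider "k \<in> {0..<int i}" | "k \<in> {int i..<int (j + L)}" | "k \<in> {int (j + L)..<int n}"
          using k by force
        then show ?thesis
        proof cases
          case 1
          with eq show ?thesis by (simp add: block_eq_iff_interval)
        next
          case 2
          with xz[OF B(1)] xz[OF B(2)] have "x B k = z B k" "x B' k = z B' k" by auto
          with eq k show ?thesis by (simp add: block_eq_iff_interval)
        next
          case 3
          with eq j(2) show ?thesis by (simp add: block_eq_iff_interval)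
        qed
      qed
      then have "block (x B) 0 n = block (x B') 0 n" by (simp add: block_eq_iff_interval)
      with xz[OF B(1)] xz[OF B(2)] show "B = B'" by metis
    qed
    show "block (z B) 0 n \<in> lifts UNIV 0 n y" if "B \<in> lifts {0..<int n} 0 n y" for B
      using xz[OF that] factor_eq_iff by (intro liftsI) auto
    show "s_weight X f B \<le> exp (2 * f_bound * real (i + ?m)) * s_weight X f (block (z B) 0 n)"
      if "B \<in> lifts {0..<int n} 0 n y" for B
      using xz[OF that] s_weight_block_comparison[of "x B" "z B" "j + L" n i] j(2) by auto
  qed (use finite_lifts finite_words[where 'a = 'a] s_weight_lifts_bounds(3) in \<open>auto intro: less_imp_le\<close>)
  also have "exp (2 * f_bound * real (i + ?m)) * real (card (?W i \<times> ?W ?m)) =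
      (exp (2 * f_bound) * CARD('a)) ^ (i + ?m)"
    unfolding card_cartesian_product card_words
    by (simp add: power_mult_distrib power_add exp_add algebra_simps flip: exp_of_nat_mult)
  finally show ?thesis unfolding lift_sum_def .
qed

text \<open>One early visit \<open>i\<close> is kept fixed, while the late visit \<open>j\<close>
  moves with \<open>n\<close> and misses it by o(n). The logarithmic cost is thus a constant plus
  o(n).\<close>

lemma growth_rates_agree:
  assumes mem: "has_memory X L"
    and y: "y \<in> Y"
    and past: "\<forall>\<^sub>F n in sequentially. \<exists>j\<le>n. (shift ^^ j) y \<in> settled (past L) L K \<and> 2 * (n - j) \<le> n"
    and future: "\<And>q. q > 0 \<Longrightarrow>
      \<forall>\<^sub>F n in sequentially. \<exists>j\<le>n. (shift ^^ j) y \<in> settled (future L) L K' \<and> q * (n - j) \<le> n"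
  shows "limsup (\<lambda>n. ereal (1 / real n * ln (lift_sum {0..<int n} n y))) =
    limsup (\<lambda>n. ereal (1 / real n * ln (lift_sum UNIV n y)))"
proof (rule antisym)
  show "limsup (\<lambda>n. ereal (1 / real n * ln (lift_sum UNIV n y))) \<le>
      limsup (\<lambda>n. ereal (1 / real n * ln (lift_sum {0..<int n} n y)))"
    using lift_sum_pos[OF y] lift_sum_antimono[of _ UNIV]
    by (intro limsup_rate_ln_le[where C = 1]) auto
  obtain N0 where N0: "\<And>n. n \<ge> N0 \<Longrightarrow> \<exists>j\<le>n. (shift ^^ j) y \<in> settled (past L) L K \<and> 2 * (n - j) \<le> n"
    using past unfolding eventually_sequentially by blast
  \<comment> \<open>At time \<open>n = N0 + 2 * K\<close> the visit found has
    \<open>2 * j \<ge> n\<close>, hence \<open>j \<ge> K\<close>.\<close>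
  obtain i where i: "(shift ^^ i) y \<in> settled (past L) L K" "K \<le> i"
    using N0[of "N0 + 2 * K"] by force
  \<comment> \<open>The logarithmic cost of one symbol outside the window of agreement.\<close>
  define A where "A = ln (exp (2 * f_bound) * CARD('a))"
  have A: "0 \<le> A" unfolding A_def using f_bound_nonneg by (simp add: ln_mult)
  show "limsup (\<lambda>n. ereal (1 / real n * ln (lift_sum {0..<int n} n y))) \<le>
      limsup (\<lambda>n. ereal (1 / real n * ln (lift_sum UNIV n y)))"
  proof (rule limsup_rate_le)
    fix e :: real assume e: "e > 0"
    obtain q0 :: nat where q0: "A / e \<le> real q0" using real_arch_simple by blast
    \<comment> \<open>The summand 2 secures \<open>q \<ge> 2\<close>, which places the late visit
      after \<open>i\<close>.\<close>
    define q where "q = q0 + 2"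
    have q: "q \<ge> 2" "A / e \<le> real q" using q0 unfolding q_def by auto
    obtain N where N: "\<And>n. n \<ge> N \<Longrightarrow>
        \<exists>j\<le>n. (shift ^^ j) y \<in> settled (future L) L K' \<and> q * (n - j) \<le> n"
      using future[of q] q(1) unfolding eventually_sequentially by auto
    have "ln (lift_sum {0..<int n} n y) \<le> ln (lift_sum UNIV n y) + e * real n + A * real (i + K')"
      if n: "n \<ge> N + 2 * i + L + K'" for n
    proof -
      \<comment> \<open>Visits are sought up to \<open>m\<close>, leaving room for
        \<open>L + K'\<close> further symbols before \<open>n\<close>.\<close>
      define m where "m = n - (L + K')"
      have m: "m \<ge> N" "m \<ge> 2 * i" "m + L + K' = n" using n unfolding m_def by auto
      from N[OF m(1)] obtain j where j: "j \<le> m" "(shift ^^ j) y \<in> settled (future L) L K'"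
        "q * (m - j) \<le> m" by blast
      have "2 * (m - j) \<le> m" using q(1) j(3) by (meson le_trans mult_le_mono1)
      then have "i \<le> j" using m(2) j(1) by linarith
      have t: "n - (j + L) = m - j + K'" using m(3) j(1) by linarith
      have "lift_sum {0..<int n} n y \<le>
          (exp (2 * f_bound) * CARD('a)) ^ (i + (n - (j + L))) * lift_sum UNIV n y"
        using lift_sum_le_fibre[OF mem i j(2) _ \<open>i \<le> j\<close>, of n] m(3) j(1) by auto
      then have "ln (lift_sum {0..<int n} n y) \<le>
          ln ((exp (2 * f_bound) * CARD('a)) ^ (i + (n - (j + L))) * lift_sum UNIV n y)"
        using lift_sum_pos[OF y] by simp
      also have "\<dots> = A * real (i + (n - (j + L))) + ln (lift_sum UNIV n y)"
        using lift_sum_pos[OF y, of UNIV n] unfolding A_def by (simp add: ln_mult ln_realpow)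
      also have "A * real (i + (n - (j + L))) = A * real (m - j) + A * real (i + K')"
        unfolding t by (simp add: algebra_simps)
      \<comment> \<open>By the choice of \<open>q\<close>, \<open>A \<le> e * q\<close>, while
        \<open>q * (m - j) \<le> m \<le> n\<close>.\<close>
      also have "A * real (m - j) \<le> e * real n"
      proof -
        have "A * real (m - j) \<le> (e * real q) * real (m - j)"
          using q(2) e by (intro mult_right_mono) (auto simp: field_simps)
        also have "\<dots> = e * real (q * (m - j))" by simp
        also have "\<dots> \<le> e * real n" using e j(3) m(3) by (intro mult_left_mono of_nat_mono) auto
        finally show ?thesis .
      qed
      finally show ?thesis by simp
    qed
    then show "\<exists>c. \<forall>\<^sub>F n in sequentially. ln (lift_sum {0..<int n} n y) \<le>
        ln (lift_sum UNIV n y) + e * real n + c"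
      unfolding eventually_sequentially by blast
  qed
qed

end

section \<open>Almost everywhere equality and integration\<close>

theorem theorem1:
  fixes X :: "(int \<Rightarrow> 'a::{finite,discrete_topology}) set"
    and Y :: "(int \<Rightarrow> 'b::{finite,discrete_topology}) set"
    and \<pi> :: "(int \<Rightarrow> 'a) \<Rightarrow> (int \<Rightarrow> 'b)"
    and \<pi>\<^sub>0 :: "'a \<Rightarrow> 'b"
    and f :: "(int \<Rightarrow> 'a) \<Rightarrow> real"
    and \<nu> :: "(int \<Rightarrow> 'b) measure"
  assumes "shift_of_finite_type X" and "irreducible_shift X"
    and "subshift Y"
    and "factor_map X Y \<pi>" and "given_by_one_block_map X \<pi> \<pi>\<^sub>0"
    and "continuous_on X f" and "depends_on_x0_x1 X f"
    and "\<nu> \<in> invariant_measures Y"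
  shows "(AE y in \<nu>. relative_pressure X \<pi> f y = Phi X \<pi>\<^sub>0 f y \<and>
                    \<bar>Phi X \<pi>\<^sub>0 f y\<bar> \<noteq> \<infinity>) \<and>
         integrable \<nu> (\<lambda>y. real_of_ereal (relative_pressure X \<pi> f y)) \<and>
         integrable \<nu> (\<lambda>y. real_of_ereal (Phi X \<pi>\<^sub>0 f y)) \<and>
         (\<integral>y. real_of_ereal (relative_pressure X \<pi> f y) \<partial>\<nu>) =
         (\<integral>y. real_of_ereal (Phi X \<pi>\<^sub>0 f y) \<partial>\<nu>)"
proof -
  interpret one_block_factor X Y \<pi> \<pi>\<^sub>0 f
    using assms by unfold_locales (auto simp: factor_map_def)
  have \<nu>: "prob_space \<nu>" "sets \<nu> = sets (restrict_space borel Y)"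
    "\<And>A. A \<in> sets \<nu> \<Longrightarrow> emeasure \<nu> (shift -` A \<inter> space \<nu>) = emeasure \<nu> A"
    using assms(8) unfolding invariant_measures_def by auto
  have space_\<nu>: "space \<nu> = Y" using sets_eq_imp_space_eq[OF \<nu>(2)] by (simp add: space_restrict_space)
  have "shift \<in> measurable (restrict_space borel Y) (restrict_space borel Y)"
    using assms(3) unfolding subshift_def
    by (intro measurable_restrict_space3[OF shift_measurable]) auto
  then interpret measure_preserving \<nu> shift
    unfolding measure_preserving_def measure_preserving_axioms_def
    using \<nu> measurable_cong_sets[OF \<nu>(2) \<nu>(2)] by auto
  have meas: "g \<in> borel_measurable \<nu>" if "g \<in> borel_measurable borel" for g :: "_ \<Rightarrow> ereal"
    using measurable_restrict_space1[OF that] measurable_cong_sets[OF \<nu>(2) refl] by blast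
  have settled: "settled J n K \<inter> Y \<in> sets \<nu>" if "\<And>M. finite (J M)" "incseq J" for J n K
    unfolding \<nu>(2) using settled_sets[OF that] by (auto simp: sets_restrict_space)
  obtain L where mem: "has_memory X L"
    using sft_has_memory[OF sft] by blast
  have J: "finite (past L M)" "incseq (past L)" "finite (future L M)" "incseq (future L)" for M
    by (auto simp: incseq_def)
  let ?dense = "\<lambda>J K y. \<forall>q>0. \<forall>\<^sub>F n in sequentially.
      \<exists>j\<le>n. (shift ^^ j) y \<in> settled (J L) L K \<inter> Y \<and> q * (n - j) \<le> n"
  \<comment> \<open>\<open>K\<close> will depend on \<open>y\<close>, so one null set must serve all
    \<open>K\<close> at once.\<close>
  have "AE y in \<nu>. \<forall>K. y \<in> settled (past L) L K \<inter> Y \<longrightarrow> ?dense past K y"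
    unfolding AE_all_countable using AE_dense_visits[OF settled[OF J(1,2)]] by blast
  moreover have "AE y in \<nu>. \<forall>K. y \<in> settled (future L) L K \<inter> Y \<longrightarrow> ?dense future K y"
    unfolding AE_all_countable using AE_dense_visits[OF settled[OF J(3,4)]] by blast
  ultimately have eq: "AE y in \<nu>. relative_pressure X \<pi> f y = Phi X \<pi>\<^sub>0 f y"
    using AE_space
  proof eventually_elim
    case (elim y)
    then have y: "y \<in> Y" using space_\<nu> by simp
    \<comment> \<open>\<open>K\<close> is chosen so that \<open>y\<close> itself lies in the set, as
      the visit statement requires.\<close>
    obtain K where "?dense past K y" using ex_settled[OF J(1,2)] elim(1) y by blast
    then have K: "\<forall>\<^sub>F n in sequentially. \<exists>j\<le>n. (shift ^^ j) y \<in> settled (past L) L K \<and> 2 * (n - j) \<le> n"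
      by (rule allE[of _ 2]) (auto elim!: eventually_mono)
    obtain K' where "?dense future K' y" using ex_settled[OF J(3,4)] elim(2) y by blast
    then have K': "\<forall>\<^sub>F n in sequentially. \<exists>j\<le>n. (shift ^^ j) y \<in> settled (future L) L K' \<and> q * (n - j) \<le> n"
      if "q > 0" for q using that by (elim allE[of _ q]) (auto elim!: eventually_mono)
    show ?case
      using growth_rates_agree[OF mem y K K'] unfolding Phi_eq relative_pressure_eq[OF y] by simp
  qed
  have rate: "\<bar>limsup (\<lambda>n. ereal (1 / real n * ln (lift_sum (I n) n y)))\<bar> \<noteq> \<infinity>"
    "\<bar>real_of_ereal (limsup (\<lambda>n. ereal (1 / real n * ln (lift_sum (I n) n y))))\<bar> \<le> ln CARD('a) + f_bound"
    if "y \<in> Y" for I y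
    using limsup_lift_sum_bound[OF that, of I]
    by (cases "limsup (\<lambda>n. ereal (1 / real n * ln (lift_sum (I n) n y)))"; simp)+
  have int: "integrable \<nu> (\<lambda>y. real_of_ereal (limsup (\<lambda>n. ereal (1 / real n * ln (lift_sum (I n) n y)))))"
    if I: "\<And>n. finite (I n) \<or> I n = UNIV" for I
  proof (rule integrable_const_bound)
    note [measurable] = lift_sum_measurable[OF I]
    have [measurable]: "(\<lambda>y. limsup (\<lambda>n. ereal (1 / real n * ln (lift_sum (I n) n y)))) \<in> borel_measurable \<nu>"
      by (rule meas) measurable
    show "(\<lambda>y. real_of_ereal (limsup (\<lambda>n. ereal (1 / real n * ln (lift_sum (I n) n y))))) \<in> borel_measurable \<nu>"
      by measurable
  qed (use rate(2) space_\<nu> in \<open>auto intro!: AE_I2\<close>)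
  \<comment> \<open>\<open>relative_pressure_eq\<close> holds only on \<open>Y\<close>, so the
    integrand is replaced on the space of \<open>\<nu>\<close>.\<close>
  have int_P: "integrable \<nu> (\<lambda>y. real_of_ereal (relative_pressure X \<pi> f y))"
    using int[of "\<lambda>_. UNIV"] relative_pressure_eq space_\<nu>
    by (subst Bochner_Integration.integrable_cong[OF refl, where g = "\<lambda>y. real_of_ereal (limsup (\<lambda>n. ereal (1 / real n * ln (lift_sum UNIV n y))))"]) auto
  have int_Phi: "integrable \<nu> (\<lambda>y. real_of_ereal (Phi X \<pi>\<^sub>0 f y))"
    unfolding Phi_eq by (rule int) simp
  have fin: "AE y in \<nu>. \<bar>Phi X \<pi>\<^sub>0 f y\<bar> \<noteq> \<infinity>"
    unfolding Phi_eq using rate(1) space_\<nu> by (intro AE_I2) auto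
  have "(\<integral>y. real_of_ereal (relative_pressure X \<pi> f y) \<partial>\<nu>) = (\<integral>y. real_of_ereal (Phi X \<pi>\<^sub>0 f y) \<partial>\<nu>)"
    by (rule integral_cong_AE) (use int_P int_Phi eq in \<open>auto elim: eventually_mono\<close>)
  with eq fin int_P int_Phi show ?thesis by auto
qed

end
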